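(* Let $n$ be an odd positive integer and let $D\subset\mathbb R^n$ be a bounded domain with $C^\infty$ boundary. If $D$ is polynomially integrable, then $D$ is convex.
   Context: A domain is a nonempty connected open set. For a bounded domain $D\subset\mathbb R^n$, $\omega\in S^{n-1}$ and $t\in\mathbb R$, the section-volume function $V_D(\omega,t)$ is the $(n-1)$-dimensional volume of $D\cap\{x\in\mathbb R^n:\langle\omega,x\rangle=t\}$, i.e. the Radon transform of the characteristic function $\chi_D$. The domain $D$ is called polynomially integrable if there are an integer $N\ge 0$ and real-valued functions $a_0,\dots,a_N$ on $S^{n-1}$ such that $V_D(\omega,t)=\sum_{j=0}^N a_j(\omega)t^j$ for all $(\omega,t)\in S^{n-1}\times\mathbb R$ such that the hyperplane $\{\langle\omega,x\rangle=t\}$ intersects $D$. *)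

theory Defs
  imports "HOL-Analysis.Analysis"
begin

definition domain_in :: "'a::euclidean_space set \<Rightarrow> bool" where
  "domain_in D \<longleftrightarrow> D \<noteq> {} \<and> connected D \<and> open D"

text \<open>For open \<open>S\<close> the next predicate is membership in \<open>C\<^sup>k(S)\<close>: all iterated directional
  derivatives of order at most \<open>k\<close> exist, and those of order \<open>k\<close> are continuous.\<close>

primrec Ck_on :: "nat \<Rightarrow> 'a::euclidean_space set \<Rightarrow> ('a \<Rightarrow> real) \<Rightarrow> bool" where
  "Ck_on 0 S f \<longleftrightarrow> continuous_on S f"
| "Ck_on (Suc k) S f \<longleftrightarrow>
     (\<forall>x\<in>S. f differentiable (at x)) \<and>
     (\<forall>v. Ck_on k S (\<lambda>x. frechet_derivative f (at x) v))"

definition smooth_on :: "'a::euclidean_space set \<Rightarrow> ('a \<Rightarrow> real) \<Rightarrow> bool" where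
  "smooth_on S f \<longleftrightarrow> (\<forall>k. Ck_on k S f)"

text \<open>Near every boundary point \<open>D\<close> is the sublevel set of a smooth local defining function with
  nonvanishing differential, so \<open>D\<close> lies locally on one side of the hypersurface \<open>frontier D\<close>.\<close>

definition smooth_boundary :: "'a::euclidean_space set \<Rightarrow> bool" where
  "smooth_boundary D \<longleftrightarrow>
     (\<forall>p\<in>frontier D. \<exists>U \<rho>. open U \<and> p \<in> U \<and> smooth_on U \<rho> \<and>
        (\<forall>x\<in>U. frechet_derivative \<rho> (at x) \<noteq> (\<lambda>v. 0)) \<and>
        D \<inter> U = {x\<in>U. \<rho> x < 0})"

definition orthonormal_basis_of :: "'a::euclidean_space set \<Rightarrow> 'a set \<Rightarrow> bool" where
  "orthonormal_basis_of B S \<longleftrightarrow>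
     B \<subseteq> S \<and> pairwise orthogonal B \<and> (\<forall>b\<in>B. norm b = 1) \<and> span B = S"

lemma orthonormal_basis_of_hyperplane_exists:
  "\<exists>B. orthonormal_basis_of B {x::'a::euclidean_space. \<omega> \<bullet> x = 0}"
proof -
  have S: "subspace {x. \<omega> \<bullet> x = 0}"
    by (rule subspace_hyperplane)
  show ?thesis
    using orthonormal_basis_subspace[OF S] unfolding orthonormal_basis_of_def by metis
qed

text \<open>Lebesgue measure of dimension \<open>DIM('a) - 1\<close> on the hyperplane \<open>\<omega> \<bullet> x = t\<close>, for a unit vector
  \<open>\<omega>\<close>: the image of the product Lebesgue measure under the isometric parametrisation given by an
  orthonormal basis of \<open>{x. \<omega> \<bullet> x = 0}\<close>. It does not depend on the basis chosen.
  In dimension one the basis is empty and this is the unit point mass at \<open>t *\<^sub>R \<omega>\<close>.\<close>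

definition hyperplane_lborel :: "'a::euclidean_space \<Rightarrow> real \<Rightarrow> 'a measure" where
  "hyperplane_lborel \<omega> t =
     (let B = (SOME B. orthonormal_basis_of B {x. \<omega> \<bullet> x = 0})
      in distr (\<Pi>\<^sub>M b\<in>B. lborel) borel (\<lambda>y. t *\<^sub>R \<omega> + (\<Sum>b\<in>B. y b *\<^sub>R b)))"

definition section_volume :: "'a::euclidean_space set \<Rightarrow> 'a \<Rightarrow> real \<Rightarrow> real" where
  "section_volume D \<omega> t = measure (hyperplane_lborel \<omega> t) (D \<inter> {x. \<omega> \<bullet> x = t})"

definition polynomially_integrable :: "'a::euclidean_space set \<Rightarrow> bool" where
  "polynomially_integrable D \<longleftrightarrow>
     (\<exists>N::nat. \<exists>a::nat \<Rightarrow> 'a \<Rightarrow> real. \<forall>\<omega>\<in>sphere 0 1. \<forall>t::real.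
        D \<inter> {x. \<omega> \<bullet> x = t} \<noteq> {} \<longrightarrow>
        section_volume D \<omega> t = (\<Sum>j\<le>N. a j \<omega> * t ^ j))"

end

theory Submission
  imports Defs
begin

text \<open>Write \<open>n = 2 M + 1\<close> and let \<open>g\<close> be the Legendre polynomial of degree \<open>2 M\<close>, cut off outside
  \<open>[-1, 1]\<close>. As the density of the first coordinate on the shell \<open>1 < \<bar>y\<bar> \<le> 2\<close> is, on
  \<open>[-1, 1]\<close>, a polynomial of degree less than \<open>2 M\<close>, the superposition of plane waves
  \<open>\<Phi>(z) = \<integral> g(y \<bullet> z) dy\<close> over the shell vanishes for \<open>\<bar>z\<bar> \<ge> 1\<close>, and it is positive for
  \<open>0 < \<bar>z\<bar> < 1\<close>. This is where odd dimension is used.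

  Let \<open>x0 \<in> D\<close> and let the ball of radius \<open>\<delta>\<close> around \<open>x0\<close> lie in the convex hull of \<open>D\<close>. By
  connectedness every hyperplane through that ball meets \<open>D\<close>. Hence for \<open>e < \<delta>\<close> the integral of
  \<open>\<Phi>((x - x0)/e)\<close> over \<open>D\<close>, being a superposition of integrals of section volumes against
  \<open>g\<close>, is a polynomial in \<open>e\<close>. For small \<open>e\<close> it equals \<open>c e\<^sup>n\<close>, the integral over the whole
  space, so it does for all \<open>e < \<delta>\<close>, and positivity of \<open>\<Phi>\<close> shows that the ball of radius
  \<open>\<delta>\<close> lies in \<open>D\<close> up to a null set, hence entirely by smoothness of the boundary. Therefore
  \<open>D\<close> is relatively closed in its convex hull, which is connected.\<close>

section \<open>Slicing by hyperplanes\<close>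

lemma PiM_lborel_translation:
  fixes v :: "'i \<Rightarrow> real"
  assumes "finite C"
  shows "distr (\<Pi>\<^sub>M i\<in>C. lborel) (\<Pi>\<^sub>M i\<in>C. lborel) (\<lambda>y. \<lambda>i\<in>C. y i + v i) = (\<Pi>\<^sub>M i\<in>C. lborel)"
proof -
  interpret product_sigma_finite "\<lambda>_::'i. lborel :: real measure"
    by (rule product_sigma_finite.intro) (rule lborel.sigma_finite_measure_axioms)
  show ?thesis
  proof (rule PiM_eqI)
    fix A :: "'i \<Rightarrow> real set"
    assume A: "\<And>i. i \<in> C \<Longrightarrow> A i \<in> sets lborel"
    let ?T = "\<lambda>y. \<lambda>i\<in>C. y i + v i"
    \<comment> \<open>The preimage of a box is a translated box, which reduces the claim to
      translation invariance in each coordinate. Restricting to \<open>C\<close> keeps the shifted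
      function in the space of the product measure.\<close>
    have pre: "?T -` (Pi\<^sub>E C A) \<inter> space (\<Pi>\<^sub>M i\<in>C. lborel) = Pi\<^sub>E C (\<lambda>i. (+) (v i) -` A i)"
      by (auto simp: space_PiM PiE_def Pi_def extensional_def add.commute)
    have "emeasure (distr (\<Pi>\<^sub>M i\<in>C. lborel) (\<Pi>\<^sub>M i\<in>C. lborel) ?T) (Pi\<^sub>E C A)
        = emeasure (\<Pi>\<^sub>M i\<in>C. lborel) (Pi\<^sub>E C (\<lambda>i. (+) (v i) -` A i))"
      using A assms by (subst emeasure_distr) (auto simp: pre[simplified] intro!: sets_PiM_I_finite)
    also have "\<dots> = (\<Prod>i\<in>C. emeasure lborel ((+) (v i) -` A i))"
    proof (rule emeasure_PiM)
      fix i assume "i \<in> C"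
      then have "(+) (v i) -` A i \<inter> space borel \<in> sets borel"
        using A by (intro measurable_sets[where A=borel]) auto
      then show "(+) (v i) -` A i \<in> sets lborel" by simp
    qed (use assms in auto)
    also have "\<dots> = (\<Prod>i\<in>C. emeasure lborel (A i))"
    proof (rule prod.cong[OF refl])
      fix i assume "i \<in> C"
      then have "emeasure (distr lborel borel ((+) (v i))) (A i) = emeasure lborel ((+) (v i) -` A i)"
        using A by (subst emeasure_distr) auto
      then show "emeasure lborel ((+) (v i) -` A i) = emeasure lborel (A i)"
        by (simp add: lborel_distr_plus)
    qed
    finally show "emeasure (distr (\<Pi>\<^sub>M i\<in>C. lborel) (\<Pi>\<^sub>M i\<in>C. lborel) ?T) (Pi\<^sub>E C A)
        = (\<Prod>i\<in>C. emeasure lborel (A i))" .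
  qed (use assms in auto)
qed

lemma orthonormal_inner:
  assumes "orthonormal_basis_of B S" "a \<in> B" "b \<in> B"
  shows "a \<bullet> b = (if a = b then 1 else 0)"
  using assms unfolding orthonormal_basis_of_def pairwise_def orthogonal_def
  by (auto simp: norm_eq_1)

lemma orthonormal_basis_of_independent:
  assumes "orthonormal_basis_of B S"
  shows "independent B"
  using assms unfolding orthonormal_basis_of_def
  by (intro pairwise_orthogonal_independent) auto

lemma orthonormal_basis_of_finite:
  "orthonormal_basis_of B S \<Longrightarrow> finite B"
  using orthonormal_basis_of_independent independent_imp_finite by blast

lemma orthonormal_sum_inner:
  assumes "orthonormal_basis_of B S" "b \<in> B"
  shows "(\<Sum>c\<in>B. y c *\<^sub>R c) \<bullet> b = y b"
  using orthonormal_basis_of_finite[OF assms(1)] assms(2)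
  by (simp add: inner_sum_left orthonormal_inner[OF assms(1) _ assms(2)] if_distrib cong: if_cong sum.cong)

lemma orthonormal_sum_norm:
  assumes "orthonormal_basis_of B S"
  shows "(norm (\<Sum>c\<in>B. y c *\<^sub>R c))\<^sup>2 = (\<Sum>c\<in>B. (y c)\<^sup>2)"
  unfolding power2_norm_eq_inner
  by (simp add: inner_sum_right orthonormal_sum_inner[OF assms] power2_eq_square cong: sum.cong)

lemma orthonormal_expansion:
  assumes B: "orthonormal_basis_of B S" and v: "v \<in> S"
  shows "(\<Sum>c\<in>B. (v \<bullet> c) *\<^sub>R c) = v"
proof -
  have "v \<in> span B" using assms unfolding orthonormal_basis_of_def by auto
  then obtain u where u: "v = (\<Sum>c\<in>B. u c *\<^sub>R c)"
    using orthonormal_basis_of_finite[OF B] by (auto simp: span_finite)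
  show ?thesis
    using orthonormal_sum_inner[OF B, of _ u] by (simp add: u cong: sum.cong)
qed

lemma measurable_orthonormal_sum [measurable]:
  "(\<lambda>y. \<Sum>c\<in>C. y c *\<^sub>R c) \<in> (\<Pi>\<^sub>M c\<in>C. lborel) \<rightarrow>\<^sub>M (borel :: 'a::euclidean_space measure)"
  by (intro borel_measurable_sum borel_measurable_scaleR) auto

text \<open>The norm of the sum is the Euclidean length of the coefficient vector, so the ball pulls
  back to a Euclidean ball in \<open>card C\<close> coordinates. With \<open>S\<close> arbitrary
  this serves both for the whole space and for a hyperplane.\<close>

lemma emeasure_orthonormal_cball:
  fixes C :: "'a::euclidean_space set"
  assumes C: "orthonormal_basis_of C S" and r: "r > 0"
  shows "emeasure (distr (\<Pi>\<^sub>M c\<in>C. lborel) borel (\<lambda>y. \<Sum>c\<in>C. y c *\<^sub>R c)) (cball 0 r)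
       = ennreal (unit_ball_vol (real (card C)) * r ^ card C)"
proof -
  have "norm (\<Sum>c\<in>C. y c *\<^sub>R c) = sqrt (\<Sum>c\<in>C. (y c)\<^sup>2)" for y
    using orthonormal_sum_norm[OF C, of y] by (simp add: real_sqrt_unique)
  then have "(\<lambda>y. \<Sum>c\<in>C. y c *\<^sub>R c) -` cball 0 r = {f. sqrt (\<Sum>i\<in>C. (f i)\<^sup>2) \<le> r}"
    by auto
  then show ?thesis
    using emeasure_cball_aux[OF orthonormal_basis_of_finite[OF C] r] by (subst emeasure_distr) auto
qed

text \<open>Both measures are translation invariant and give the unit ball \<open>B = -B\<close> the same mass;
  Fubini applied to the indicator of \<open>{(x, y). x + y \<in> A \<and> y \<in> B}\<close> then identifies them.\<close>

lemma lborel_eq_distr_orthonormal: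
  fixes C :: "'a::euclidean_space set"
  assumes C: "orthonormal_basis_of C UNIV"
  shows "distr (\<Pi>\<^sub>M c\<in>C. lborel) borel (\<lambda>y. \<Sum>c\<in>C. y c *\<^sub>R c) = lborel"
proof -
  let ?P = "\<Pi>\<^sub>M c\<in>C. lborel :: real measure" and ?s = "\<lambda>y. \<Sum>c\<in>C. y c *\<^sub>R c"
  define \<mu> where "\<mu> = distr ?P borel ?s"
  have finC: "finite C" by (rule orthonormal_basis_of_finite[OF C])
  have card: "card C = DIM('a)"
    using orthonormal_basis_of_independent[OF C] C unfolding orthonormal_basis_of_def
    by (metis dim_UNIV dim_span_eq_card_independent)
  have [simp]: "sets \<mu> = sets borel" "space \<mu> = UNIV" by (auto simp: \<mu>_def)
  have [measurable_cong]: "sets \<mu> = sets borel" by simp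
  have ball: "emeasure \<mu> (cball 0 r) = emeasure lborel (cball 0 r :: 'a set)" if "r > 0" for r
    using emeasure_orthonormal_cball[OF C that] emeasure_cball[of r "0::'a"] that
    unfolding \<mu>_def card by simp
  have trans: "(\<integral>\<^sup>+x. f (x + v) \<partial>\<mu>) = (\<integral>\<^sup>+x. f x \<partial>\<mu>)"
    if [measurable]: "f \<in> borel_measurable borel" for f and v :: 'a
  proof -
    have "(\<integral>\<^sup>+x. f x \<partial>\<mu>) = (\<integral>\<^sup>+y. f (?s y) \<partial>?P)"
      unfolding \<mu>_def by (subst nn_integral_distr) auto
    \<comment> \<open>Translating by \<open>v\<close> in space means shifting the coordinates by the
      numbers \<open>v \<bullet> i\<close>.\<close>
    also have "\<dots> = (\<integral>\<^sup>+y. f (?s y) \<partial>distr ?P ?P (\<lambda>y. \<lambda>i\<in>C. y i + v \<bullet> i))"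
      by (simp only: PiM_lborel_translation[OF finC])
    also have "\<dots> = (\<integral>\<^sup>+y. f (?s (\<lambda>i\<in>C. y i + v \<bullet> i)) \<partial>?P)"
      by (subst nn_integral_distr) auto
    also have "\<dots> = (\<integral>\<^sup>+y. f (?s y + v) \<partial>?P)"
      using orthonormal_expansion[OF C, of v]
      by (simp add: scaleR_left_distrib sum.distrib cong: sum.cong)
    also have "\<dots> = (\<integral>\<^sup>+x. f (x + v) \<partial>\<mu>)"
      unfolding \<mu>_def by (subst nn_integral_distr) auto
    finally show ?thesis by simp
  qed
  have ltrans: "(\<integral>\<^sup>+x. f (x + v) \<partial>lborel) = (\<integral>\<^sup>+x. f x \<partial>lborel)"
    if [measurable]: "f \<in> borel_measurable borel" for f and v :: 'a
  proof -
    have "(\<integral>\<^sup>+x. f x \<partial>distr lborel borel ((+) v)) = (\<integral>\<^sup>+x. f (v + x) \<partial>lborel)"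
      by (subst nn_integral_distr) auto
    then show ?thesis by (simp add: lborel_distr_plus add.commute)
  qed
  have "sigma_finite_measure \<mu>"
  proof (rule sigma_finite_measure.intro)
    have "emeasure \<mu> (cball 0 r) \<noteq> \<infinity>" for r
    proof (cases "r > 0")
      case True then show ?thesis by (simp add: ball emeasure_cball)
    next
      case False
      have "emeasure \<mu> (cball 0 r) \<le> emeasure \<mu> (cball 0 1)"
        using False by (intro emeasure_mono) auto
      also have "\<dots> < \<infinity>" by (simp add: ball emeasure_cball)
      finally show ?thesis by simp
    qed
    moreover have "(\<Union>n::nat. cball 0 (real n)) = (UNIV :: 'a set)"
      using real_arch_simple by (auto simp: dist_norm)
    ultimately show "\<exists>A. countable A \<and> A \<subseteq> sets \<mu> \<and> \<Union> A = space \<mu> \<and> (\<forall>a\<in>A. emeasure \<mu> a \<noteq> \<infinity>)"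
      by (intro exI[of _ "range (\<lambda>n::nat. cball 0 (real n))"]) auto
  qed
  then interpret \<mu>: sigma_finite_measure \<mu> .
  interpret pair_sigma_finite \<mu> lborel ..
  let ?B = "cball (0::'a) 1"
  have [measurable]: "?B \<in> sets borel" by simp
  have "\<mu> = lborel"
  proof (rule measure_eqI)
    fix A :: "'a set" assume "A \<in> sets \<mu>"
    then have [measurable]: "A \<in> sets borel" by simp
    have "emeasure \<mu> A * emeasure lborel ?B = (\<integral>\<^sup>+y. (\<integral>\<^sup>+x. indicator A x * indicator ?B y \<partial>\<mu>) \<partial>lborel)"
      by (simp add: nn_integral_multc nn_integral_cmult_indicator)
    also have "\<dots> = (\<integral>\<^sup>+y. (\<integral>\<^sup>+x. indicator A (x + y) * indicator ?B y \<partial>\<mu>) \<partial>lborel)"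
    proof (rule nn_integral_cong)
      fix y :: 'a
      show "(\<integral>\<^sup>+x. indicator A x * indicator ?B y \<partial>\<mu>)
          = (\<integral>\<^sup>+x. indicator A (x + y) * indicator ?B y \<partial>\<mu>)"
        using trans[of "\<lambda>x. indicator A x * indicator ?B y" y] by simp
    qed
    also have "\<dots> = (\<integral>\<^sup>+x. (\<integral>\<^sup>+y. indicator A (x + y) * indicator ?B y \<partial>lborel) \<partial>\<mu>)"
      by (rule Fubini') measurable
    \<comment> \<open>Replacing \<open>y\<close> by \<open>y - x\<close> moves the shift from
      \<open>A\<close> to the ball, and symmetry of the ball turns \<open>y - x\<close> into
      \<open>x - y\<close>. After a second exchange of integrals, invariance of \<mu> removes the
      shift.\<close>
    also have "\<dots> = (\<integral>\<^sup>+x. (\<integral>\<^sup>+y. indicator A y * indicator ?B (x + - y) \<partial>lborel) \<partial>\<mu>)"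
    proof (rule nn_integral_cong)
      fix x :: 'a
      have "(\<integral>\<^sup>+y. indicator A y * indicator ?B (x + - y) \<partial>lborel)
          = (\<integral>\<^sup>+y. indicator A (y + x) * indicator ?B (x + - (y + x)) \<partial>lborel)"
        by (subst ltrans[symmetric, of _ x]) auto
      then show "(\<integral>\<^sup>+y. indicator A (x + y) * indicator ?B y \<partial>lborel)
          = (\<integral>\<^sup>+y. indicator A y * indicator ?B (x + - y) \<partial>lborel)"
        by (simp add: add.commute indicator_def)
    qed
    also have "\<dots> = (\<integral>\<^sup>+y. (\<integral>\<^sup>+x. indicator A y * indicator ?B (x + - y) \<partial>\<mu>) \<partial>lborel)"
      by (rule Fubini'[symmetric]) measurable
    also have "\<dots> = (\<integral>\<^sup>+y. (\<integral>\<^sup>+x. indicator A y * indicator ?B x \<partial>\<mu>) \<partial>lborel)"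
    proof (rule nn_integral_cong)
      fix y :: 'a
      show "(\<integral>\<^sup>+x. indicator A y * indicator ?B (x + - y) \<partial>\<mu>)
          = (\<integral>\<^sup>+x. indicator A y * indicator ?B x \<partial>\<mu>)"
        by (rule trans) measurable
    qed
    also have "\<dots> = emeasure lborel A * emeasure lborel ?B"
      by (simp add: nn_integral_multc nn_integral_cmult ball)
    finally have eq: "emeasure \<mu> A * emeasure lborel ?B = emeasure lborel A * emeasure lborel ?B" .
    have "emeasure lborel ?B \<noteq> 0" "emeasure lborel ?B \<noteq> top"
      using unit_ball_vol_pos[of "DIM('a)"] by (auto simp: emeasure_cball simp del: unit_ball_vol_pos)
    then show "emeasure \<mu> A = emeasure lborel A"
      using arg_cong[OF eq, of "\<lambda>u. u / emeasure lborel ?B"] by (simp add: mult_divide_eq_ennreal)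
  qed simp
  then show ?thesis by (simp add: \<mu>_def)
qed

section \<open>Disintegration of Lebesgue measure over parallel hyperplanes\<close>

lemma hyperplane_lborel_alt:
  fixes \<omega> :: "'a::euclidean_space"
  obtains B where "orthonormal_basis_of B {x. \<omega> \<bullet> x = 0}"
    "hyperplane_lborel \<omega> = (\<lambda>t. distr (\<Pi>\<^sub>M b\<in>B. lborel) borel (\<lambda>y. t *\<^sub>R \<omega> + (\<Sum>b\<in>B. y b *\<^sub>R b)))"
  \<comment> \<open>The basis picked by \<open>SOME\<close> depends on \<omega> alone, so a single
    basis serves all \<open>t\<close>. This makes Fubini applicable in the variable
    \<open>t\<close>.\<close>
  by (rule that[OF someI_ex[OF orthonormal_basis_of_hyperplane_exists[of \<omega>]]])
    (simp add: hyperplane_lborel_def Let_def fun_eq_iff)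

lemma sets_hyperplane_lborel [simp, measurable_cong]:
  "sets (hyperplane_lborel \<omega> t) = sets borel"
  unfolding hyperplane_lborel_def by (simp add: Let_def)

lemma orthonormal_basis_of_insert_normal:
  fixes \<omega> :: "'a::euclidean_space"
  assumes B: "orthonormal_basis_of B {x. \<omega> \<bullet> x = 0}" and \<omega>: "norm \<omega> = 1"
  shows "\<omega> \<notin> B" "orthonormal_basis_of (insert \<omega> B) UNIV"
proof -
  have ww: "\<omega> \<bullet> \<omega> = 1" using \<omega> by (simp add: norm_eq_1)
  have sub: "B \<subseteq> {x. \<omega> \<bullet> x = 0}" and sp: "span B = {x. \<omega> \<bullet> x = 0}"
    using B unfolding orthonormal_basis_of_def by auto
  show "\<omega> \<notin> B" using sub ww by auto
  have "x \<in> span (insert \<omega> B)" for x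
  proof -
    have "x - (\<omega> \<bullet> x) *\<^sub>R \<omega> \<in> span B" by (simp add: sp inner_diff_right ww)
    then show ?thesis unfolding span_insert by blast
  qed
  then show "orthonormal_basis_of (insert \<omega> B) UNIV"
    using B sub \<omega> unfolding orthonormal_basis_of_def pairwise_insert
    by (auto simp: orthogonal_def inner_commute)
qed

lemma AE_hyperplane_lborel:
  fixes \<omega> :: "'a::euclidean_space"
  assumes "norm \<omega> = 1"
  shows "AE x in hyperplane_lborel \<omega> t. \<omega> \<bullet> x = t"
proof -
  obtain B where B: "orthonormal_basis_of B {x. \<omega> \<bullet> x = 0}"
    and h: "hyperplane_lborel \<omega> = (\<lambda>t. distr (\<Pi>\<^sub>M b\<in>B. lborel) borel (\<lambda>y. t *\<^sub>R \<omega> + (\<Sum>b\<in>B. y b *\<^sub>R b)))"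
    by (rule hyperplane_lborel_alt[of \<omega>])
  have "\<omega> \<bullet> b = 0" if "b \<in> B" for b
    using B that unfolding orthonormal_basis_of_def by auto
  then have "\<omega> \<bullet> (t *\<^sub>R \<omega> + (\<Sum>b\<in>B. y b *\<^sub>R b)) = t" for y
    using assms by (simp add: inner_add_right inner_sum_right norm_eq_1)
  then show ?thesis
    unfolding h by (subst AE_distr_iff) auto
qed

text \<open>Adding the unit normal \<omega> to an orthonormal basis of the hyperplane gives one of
  the whole space. In these coordinates Lebesgue measure is a product, and Tonelli with the
  \<omega>-coordinate outermost is the slicing formula.\<close>

lemma
  fixes \<omega> :: "'a::euclidean_space" and f :: "'a \<Rightarrow> ennreal"
  assumes \<omega>: "norm \<omega> = 1" and f[measurable]: "f \<in> borel_measurable borel"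
  shows borel_measurable_nn_integral_hyperplane:
      "(\<lambda>t. \<integral>\<^sup>+x. f x \<partial>hyperplane_lborel \<omega> t) \<in> borel_measurable borel" (is ?meas)
    and nn_integral_lborel_hyperplane:
      "(\<integral>\<^sup>+x. f x \<partial>lborel) = (\<integral>\<^sup>+t. (\<integral>\<^sup>+x. f x \<partial>hyperplane_lborel \<omega> t) \<partial>lborel)" (is ?eq)
proof -
  obtain B where B: "orthonormal_basis_of B {x. \<omega> \<bullet> x = 0}"
    and h: "hyperplane_lborel \<omega> = (\<lambda>t. distr (\<Pi>\<^sub>M b\<in>B. lborel) borel (\<lambda>y. t *\<^sub>R \<omega> + (\<Sum>b\<in>B. y b *\<^sub>R b)))"
    by (rule hyperplane_lborel_alt[of \<omega>])
  note C = orthonormal_basis_of_insert_normal[OF B \<omega>]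
  have fin: "finite B" by (rule orthonormal_basis_of_finite[OF B])
  interpret product_sigma_finite "\<lambda>_::'a. lborel :: real measure"
    by (rule product_sigma_finite.intro) (rule lborel.sigma_finite_measure_axioms)
  interpret P: finite_product_sigma_finite "\<lambda>_::'a. lborel :: real measure" B
    by standard (rule fin)
  have inner: "(\<integral>\<^sup>+x. f x \<partial>hyperplane_lborel \<omega> t)
      = (\<integral>\<^sup>+y. f (t *\<^sub>R \<omega> + (\<Sum>b\<in>B. y b *\<^sub>R b)) \<partial>(\<Pi>\<^sub>M b\<in>B. lborel))" for t
    unfolding h by (subst nn_integral_distr) auto
  show ?meas unfolding inner by measurable
  have "(\<integral>\<^sup>+x. f x \<partial>lborel)
      = (\<integral>\<^sup>+y. f (\<Sum>c\<in>insert \<omega> B. y c *\<^sub>R c) \<partial>(\<Pi>\<^sub>M b\<in>insert \<omega> B. lborel))"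
    by (subst lborel_eq_distr_orthonormal[OF C(2), symmetric], subst nn_integral_distr) auto
  also have "\<dots> = (\<integral>\<^sup>+t. (\<integral>\<^sup>+y. f (\<Sum>c\<in>insert \<omega> B. (y(\<omega> := t)) c *\<^sub>R c) \<partial>(\<Pi>\<^sub>M b\<in>B. lborel)) \<partial>lborel)"
    by (rule product_nn_integral_insert_rev[OF fin C(1)]) measurable
  also have "\<dots> = (\<integral>\<^sup>+t. (\<integral>\<^sup>+x. f x \<partial>hyperplane_lborel \<omega> t) \<partial>lborel)"
  proof -
    have "(\<Sum>c\<in>B. (y(\<omega> := t)) c *\<^sub>R c) = (\<Sum>c\<in>B. y c *\<^sub>R c)" for y :: "'a \<Rightarrow> real" and t
      using C(1) by (intro sum.cong) auto
    then show ?thesis unfolding inner using C(1) fin by simp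
  qed
  finally show ?eq .
qed

section \<open>Sections of balls, and section volumes as densities\<close>

lemma orthonormal_basis_of_hyperplane_card:
  fixes \<omega> :: "'a::euclidean_space"
  assumes B: "orthonormal_basis_of B {x. \<omega> \<bullet> x = 0}" and \<omega>: "norm \<omega> = 1"
  shows "card B = DIM('a) - 1"
proof -
  note C = orthonormal_basis_of_insert_normal(2)[OF B \<omega>]
  have "dim (span (insert \<omega> B)) = card (insert \<omega> B)"
    by (rule dim_span_eq_card_independent[OF orthonormal_basis_of_independent[OF C]])
  then have "card (insert \<omega> B) = DIM('a)"
    using C unfolding orthonormal_basis_of_def by simp
  then show ?thesis
    using orthonormal_basis_of_insert_normal(1)[OF B \<omega>] orthonormal_basis_of_finite[OF B] by simp
qed

text \<open>By Pythagoras the section is a ball of radius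
  \<open>sqrt (r\<^sup>2 - t\<^sup>2)\<close> in dimension \<open>DIM('a) - 1\<close>. The tangent
  case is excluded because in dimension one the touching point has mass 1, not 0.\<close>

lemma emeasure_hyperplane_cball:
  fixes \<omega> :: "'a::euclidean_space"
  assumes \<omega>: "norm \<omega> = 1" and "0 < r" and t: "\<bar>t\<bar> \<noteq> r"
  shows "emeasure (hyperplane_lborel \<omega> t) (cball 0 r)
    = ennreal (if \<bar>t\<bar> < r then unit_ball_vol (real (DIM('a) - 1)) * sqrt (r\<^sup>2 - t\<^sup>2) ^ (DIM('a) - 1) else 0)"
proof -
  obtain B where B: "orthonormal_basis_of B {x. \<omega> \<bullet> x = 0}"
    and h: "hyperplane_lborel \<omega> = (\<lambda>t. distr (\<Pi>\<^sub>M b\<in>B. lborel) borel (\<lambda>y. t *\<^sub>R \<omega> + (\<Sum>b\<in>B. y b *\<^sub>R b)))"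
    by (rule hyperplane_lborel_alt[of \<omega>])
  let ?s = "\<lambda>y. \<Sum>b\<in>B. y b *\<^sub>R b"
  have [simp]: "\<omega> \<bullet> b = 0" if "b \<in> B" for b
    using B that unfolding orthonormal_basis_of_def by auto
  then have [simp]: "b \<bullet> \<omega> = 0" if "b \<in> B" for b
    using that by (simp add: inner_commute)
  have nrm: "(norm (t *\<^sub>R \<omega> + ?s y))\<^sup>2 = t\<^sup>2 + (norm (?s y))\<^sup>2" for y
    unfolding power2_norm_eq_inner using \<omega>
    by (simp add: inner_add_left inner_add_right inner_sum_right inner_sum_left norm_eq_1 power2_eq_square)
  have eq: "emeasure (hyperplane_lborel \<omega> t) (cball 0 r)
      = emeasure (\<Pi>\<^sub>M b\<in>B. lborel) ((\<lambda>y. t *\<^sub>R \<omega> + ?s y) -` cball 0 r \<inter> space (\<Pi>\<^sub>M b\<in>B. lborel))"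
    unfolding h by (subst emeasure_distr) auto
  have mem: "t *\<^sub>R \<omega> + ?s y \<in> cball 0 r \<longleftrightarrow> (norm (?s y))\<^sup>2 \<le> r\<^sup>2 - t\<^sup>2" for y
  proof -
    have "norm (t *\<^sub>R \<omega> + ?s y) \<le> r \<longleftrightarrow> (norm (t *\<^sub>R \<omega> + ?s y))\<^sup>2 \<le> r\<^sup>2"
      using \<open>0 < r\<close> abs_le_square_iff[of "norm (t *\<^sub>R \<omega> + ?s y)" r] by simp
    then show ?thesis unfolding nrm by auto
  qed
  show ?thesis
  proof (cases "\<bar>t\<bar> < r")
    case True
    then have pos: "r\<^sup>2 - t\<^sup>2 > 0"
      using power_strict_mono[of "\<bar>t\<bar>" r 2] by simp
    have "t *\<^sub>R \<omega> + ?s y \<in> cball 0 r \<longleftrightarrow> ?s y \<in> cball 0 (sqrt (r\<^sup>2 - t\<^sup>2))" for y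
      unfolding mem using pos abs_le_square_iff[of "norm (?s y)" "sqrt (r\<^sup>2 - t\<^sup>2)"] by simp
    then have "emeasure (hyperplane_lborel \<omega> t) (cball 0 r)
        = emeasure (distr (\<Pi>\<^sub>M b\<in>B. lborel) borel ?s) (cball 0 (sqrt (r\<^sup>2 - t\<^sup>2)))"
      unfolding eq by (subst emeasure_distr) (auto simp: vimage_def)
    then show ?thesis
      using emeasure_orthonormal_cball[OF B, of "sqrt (r\<^sup>2 - t\<^sup>2)"] pos True
      by (simp add: orthonormal_basis_of_hyperplane_card[OF B \<omega>])
  next
    case False
    then have "r\<^sup>2 < t\<^sup>2"
      using t \<open>0 < r\<close> power_strict_mono[of r "\<bar>t\<bar>" 2] by simp
    then have "\<not> (norm (?s y))\<^sup>2 \<le> r\<^sup>2 - t\<^sup>2" for y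
      using zero_le_power2[of "norm (?s y)"] by linarith
    then have "(\<lambda>y. t *\<^sub>R \<omega> + ?s y) -` cball 0 r = {}" using mem by auto
    then show ?thesis unfolding eq using False by simp
  qed
qed

lemma emeasure_hyperplane_bounded:
  fixes A :: "'a::euclidean_space set"
  assumes "norm \<omega> = 1" and [measurable]: "A \<in> sets borel" and "bounded A"
  shows "emeasure (hyperplane_lborel \<omega> t) A = ennreal (section_volume A \<omega> t)"
proof -
  obtain r where r: "r > \<bar>t\<bar>" "A \<subseteq> cball 0 r"
  proof -
    obtain a where "\<And>x. x \<in> A \<Longrightarrow> norm x \<le> a" using \<open>bounded A\<close> bounded_iff by blast
    then have "A \<subseteq> cball 0 (max a (\<bar>t\<bar> + 1))" by fastforce
    then show ?thesis using that[of "max a (\<bar>t\<bar> + 1)"] by simp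
  qed
  have "emeasure (hyperplane_lborel \<omega> t) A \<le> emeasure (hyperplane_lborel \<omega> t) (cball 0 r)"
    using r by (intro emeasure_mono) auto
  also have "\<dots> < \<infinity>"
    using emeasure_hyperplane_cball[OF assms(1), of r t] r by simp
  finally have fin: "emeasure (hyperplane_lborel \<omega> t) A < \<infinity>" .
  have "emeasure (hyperplane_lborel \<omega> t) (A \<inter> {x. \<omega> \<bullet> x = t}) = emeasure (hyperplane_lborel \<omega> t) A"
    using AE_hyperplane_lborel[OF assms(1), of t] by (intro emeasure_eq_AE) auto
  then show ?thesis
    unfolding section_volume_def using fin by (subst emeasure_eq_ennreal_measure[symmetric]) auto
qed

lemma borel_measurable_section_volume:
  fixes A :: "'a::euclidean_space set"
  assumes "norm \<omega> = 1" and [measurable]: "A \<in> sets borel" and "bounded A"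
  shows "section_volume A \<omega> \<in> borel_measurable borel"
proof -
  have "section_volume A \<omega> t = enn2real (\<integral>\<^sup>+x. indicator A x \<partial>hyperplane_lborel \<omega> t)" for t
    using emeasure_hyperplane_bounded[OF assms, of t]
    by (simp add: section_volume_def)
  moreover have "(\<lambda>t. enn2real (\<integral>\<^sup>+x. indicator A x \<partial>hyperplane_lborel \<omega> t)) \<in> borel_measurable borel"
    using borel_measurable_nn_integral_hyperplane[OF assms(1)] by measurable
  ultimately show ?thesis by presburger
qed

text \<open>This is the slicing formula for
  \<open>indicator A x * indicator X (\<omega> \<bullet> x)\<close>, whose second factor is constant
  on each hyperplane.\<close>

lemma distr_inner_eq_density_section_volume:
  fixes A :: "'a::euclidean_space set"
  assumes "norm \<omega> = 1" and [measurable]: "A \<in> sets borel" and "bounded A"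
  shows "distr (density lborel (indicator A)) borel (\<lambda>x. \<omega> \<bullet> x)
    = density lborel (\<lambda>t. ennreal (section_volume A \<omega> t))"
proof (rule measure_eqI)
  note [measurable] = borel_measurable_section_volume[OF assms]
  fix X assume "X \<in> sets (distr (density lborel (indicator A)) borel (\<lambda>x. \<omega> \<bullet> x))"
  then have [measurable]: "X \<in> sets borel" by simp
  have "emeasure (distr (density lborel (indicator A)) borel (\<lambda>x. \<omega> \<bullet> x)) X
      = (\<integral>\<^sup>+x. indicator A x * indicator X (\<omega> \<bullet> x) \<partial>lborel)"
  proof -
    have "emeasure (distr (density lborel (indicator A)) borel (\<lambda>x. \<omega> \<bullet> x)) X
      = emeasure (density lborel (indicator A)) ((\<lambda>x. \<omega> \<bullet> x) -` X)"
      by (subst emeasure_distr) auto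
    also have "\<dots> = (\<integral>\<^sup>+x. indicator A x * indicator ((\<lambda>x. \<omega> \<bullet> x) -` X) x \<partial>lborel)"
    proof (rule emeasure_density)
      have "(\<lambda>x. \<omega> \<bullet> x) -` X \<inter> space borel \<in> sets borel"
        by (rule measurable_sets[where A=borel]) auto
      then show "(\<lambda>x. \<omega> \<bullet> x) -` X \<in> sets lborel" by simp
    qed simp
    finally show ?thesis by (simp add: indicator_def)
  qed
  also have "\<dots> = (\<integral>\<^sup>+t. (\<integral>\<^sup>+x. indicator A x * indicator X (\<omega> \<bullet> x) \<partial>hyperplane_lborel \<omega> t) \<partial>lborel)"
    by (rule nn_integral_lborel_hyperplane[OF assms(1)]) measurable
  also have "\<dots> = (\<integral>\<^sup>+t. ennreal (section_volume A \<omega> t) * indicator X t \<partial>lborel)"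
  proof (rule nn_integral_cong)
    fix t
    have "(\<integral>\<^sup>+x. indicator A x * indicator X (\<omega> \<bullet> x) \<partial>hyperplane_lborel \<omega> t)
        = (\<integral>\<^sup>+x. indicator A x * indicator X t \<partial>hyperplane_lborel \<omega> t)"
      using AE_hyperplane_lborel[OF assms(1), of t] by (intro nn_integral_cong_AE) auto
    also have "\<dots> = ennreal (section_volume A \<omega> t) * indicator X t"
      by (simp add: nn_integral_multc emeasure_hyperplane_bounded[OF assms])
    finally show "(\<integral>\<^sup>+x. indicator A x * indicator X (\<omega> \<bullet> x) \<partial>hyperplane_lborel \<omega> t)
        = ennreal (section_volume A \<omega> t) * indicator X t" .
  qed
  also have "\<dots> = emeasure (density lborel (\<lambda>t. ennreal (section_volume A \<omega> t))) X"
    by (subst emeasure_density) auto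
  finally show "emeasure (distr (density lborel (indicator A)) borel (\<lambda>x. \<omega> \<bullet> x)) X
    = emeasure (density lborel (\<lambda>t. ennreal (section_volume A \<omega> t))) X" .
qed simp

text \<open>Both sides integrate \<open>G\<close> against the same measure on the line, once as a
  pushforward and once as a density. The two transformation rules hold for every measurable
  \<open>G\<close>, so integrability need not be discussed.\<close>

lemma integral_plane_wave:
  fixes A :: "'a::euclidean_space set" and G :: "real \<Rightarrow> real"
  assumes "norm \<omega> = 1" and [measurable]: "A \<in> sets borel" and "bounded A"
    and [measurable]: "G \<in> borel_measurable borel"
  shows "(\<integral>x. indicator A x * G (\<omega> \<bullet> x) \<partial>lborel) = (\<integral>t. section_volume A \<omega> t * G t \<partial>lborel)"
proof -
  note [measurable] = borel_measurable_section_volume[OF assms(1-3)]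
  have "(\<integral>t. G t \<partial>distr (density lborel (indicator A)) borel (\<lambda>x. \<omega> \<bullet> x))
      = (\<integral>x. G (\<omega> \<bullet> x) \<partial>density lborel (\<lambda>x. ennreal (indicator A x)))"
    by (subst integral_distr) (auto simp: ennreal_indicator)
  also have "\<dots> = (\<integral>x. indicator A x * G (\<omega> \<bullet> x) \<partial>lborel)"
    by (subst integral_density) auto
  finally show ?thesis
    unfolding distr_inner_eq_density_section_volume[OF assms(1-3)]
    by (subst (asm) integral_density) (auto simp: section_volume_def)
qed

section \<open>The Legendre kernel and its radial profile\<close>

lemma degree_shift_diff_less:
  fixes p :: "real poly"
  assumes "degree p > 0"
  shows "degree (p - pcompose p [:1, 1:]) < degree p"
proof (rule degree_lessI)
  have d: "degree (pcompose p [:1, 1:]) = degree p"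
    by (simp add: degree_pcompose)
  have l: "lead_coeff (pcompose p [:1, 1:]) = lead_coeff p"
    by (subst lead_coeff_comp) auto
  show "\<forall>k\<ge>degree p. coeff (p - pcompose p [:1, 1:]) k = 0"
  proof safe
    fix k assume "degree p \<le> k"
    then consider "k = degree p" | "k > degree p" by linarith
    then show "coeff (p - pcompose p [:1, 1:]) k = 0"
      using l d by cases (auto simp: coeff_eq_0)
  qed
qed (use assms in auto)

text \<open>Up to sign the sum is the \<open>M\<close>-th finite difference of \<open>p\<close> at
  0. Pascal's rule peels off one difference \<open>p(x) - p(x + 1)\<close>, which lowers the degree
  unless \<open>p\<close> is constant, when it is zero.\<close>

lemma alternating_binomial_sum_poly:
  fixes p :: "real poly"
  shows "degree p < M \<Longrightarrow> (\<Sum>k\<le>M. (-1) ^ k * real (M choose k) * poly p (real k)) = 0"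
proof (induction M arbitrary: p)
  case (Suc M)
  let ?q = "p - pcompose p [:1, 1:]"
  have "(\<Sum>k\<le>Suc M. (-1) ^ k * real (Suc M choose k) * poly p (real k))
      = poly p 0 + (\<Sum>k\<le>M. (-1) ^ Suc k * real (Suc M choose Suc k) * poly p (real (Suc k)))"
    by (subst sum.atMost_Suc_shift) simp
  also have "\<dots> = poly p 0 + (\<Sum>k\<le>M. (-1) ^ Suc k * real (M choose Suc k) * poly p (real (Suc k)))
      - (\<Sum>k\<le>M. (-1) ^ k * real (M choose k) * poly p (real (Suc k)))"
    by (simp add: algebra_simps sum.distrib sum_subtractf sum_negf)
  also have "poly p 0 + (\<Sum>k\<le>M. (-1) ^ Suc k * real (M choose Suc k) * poly p (real (Suc k)))
      = (\<Sum>k\<le>Suc M. (-1) ^ k * real (M choose k) * poly p (real k))"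
    by (subst sum.atMost_Suc_shift) simp
  also have "\<dots> = (\<Sum>k\<le>M. (-1) ^ k * real (M choose k) * poly p (real k))"
    by simp
  also have "\<dots> - (\<Sum>k\<le>M. (-1) ^ k * real (M choose k) * poly p (real (Suc k)))
      = (\<Sum>k\<le>M. (-1) ^ k * real (M choose k) * poly ?q (real k))"
    by (simp add: poly_pcompose algebra_simps sum_subtractf)
  also have "\<dots> = 0"
  proof (cases "degree p = 0")
    case True
    then obtain c where "p = [:c:]" by (rule degree_eq_zeroE)
    then show ?thesis by simp
  next
    case False
    then have "degree ?q < degree p" using degree_shift_diff_less by simp
    then show ?thesis using Suc.prems by (intro Suc.IH) simp
  qed
  finally show ?case .
qed simp

text \<open>The product is chosen for its divisibility: integrating \<open>u ^ (2 * k)\<close>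
  against \<open>u ^ (2 * j)\<close> over [-1, 1] brings the denominator
  \<open>2 * k + 2 * j + 1\<close>, which for \<open>j < M\<close> is one of its factors.\<close>

definition legendre_coeff :: "nat \<Rightarrow> nat \<Rightarrow> real" where
  "legendre_coeff M k = (-1) ^ k * real (M choose k) * (\<Prod>i<M. 2 * real k + 2 * real i + 1)"

text \<open>Up to a constant factor this is the Legendre polynomial of degree \<open>2 M\<close>, cut off outside
  \<open>[-1, 1]\<close>.\<close>

definition legendre_cut :: "nat \<Rightarrow> real \<Rightarrow> real" where
  "legendre_cut M u = indicator {-1..1} u * (\<Sum>k\<le>M. legendre_coeff M k * u ^ (2 * k))"

lemma borel_measurable_legendre_cut [measurable]: "legendre_cut M \<in> borel_measurable borel"
  unfolding legendre_cut_def[abs_def] by measurable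

lemma legendre_cut_eq_0: "\<bar>u\<bar> > 1 \<Longrightarrow> legendre_cut M u = 0"
  by (auto simp: legendre_cut_def indicator_def)

lemma legendre_cut_bounded: "\<bar>legendre_cut M u\<bar> \<le> (\<Sum>k\<le>M. \<bar>legendre_coeff M k\<bar>)"
proof (cases "\<bar>u\<bar> \<le> 1")
  case True
  have "\<bar>\<Sum>k\<le>M. legendre_coeff M k * u ^ (2 * k)\<bar> \<le> (\<Sum>k\<le>M. \<bar>legendre_coeff M k * u ^ (2 * k)\<bar>)"
    by (rule sum_abs)
  also have "\<dots> \<le> (\<Sum>k\<le>M. \<bar>legendre_coeff M k\<bar>)"
    using True by (intro sum_mono) (simp add: abs_mult power_abs mult_left_le power_le_one)
  finally show ?thesis using True by (simp add: legendre_cut_def abs_le_iff)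
next
  case False
  then show ?thesis by (auto simp: legendre_cut_eq_0 intro: sum_nonneg)
qed

section \<open>Beta integrals and vanishing moments\<close>

lemma integrable_Icc_continuous:
  fixes f :: "real \<Rightarrow> real"
  assumes "continuous_on UNIV f"
  shows "integrable lborel (\<lambda>u. indicator {a..b} u * f u)"
  using borel_integrable_compact[of "{a..b}" f] continuous_on_subset[OF assms]
  by simp

lemma integrable_legendre_cut_mult:
  fixes f :: "real \<Rightarrow> real"
  assumes "continuous_on UNIV f"
  shows "integrable lborel (\<lambda>u. legendre_cut M u * f u)"
  unfolding legendre_cut_def mult.assoc
  by (intro integrable_Icc_continuous continuous_intros assms)

lemma integral_even_power:
  fixes \<tau> :: real
  assumes "\<tau> \<ge> 0"
  shows "(\<integral>u. indicator {-\<tau>..\<tau>} u * u ^ (2 * k) \<partial>lborel) = 2 * \<tau> ^ (2 * k + 1) / (2 * real k + 1)"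
  using integral_power[of "-\<tau>" \<tau> "2 * k"] assms by (simp add: mult.commute)

lemma integral_even_beta:
  fixes \<tau> :: real
  assumes "\<tau> \<ge> 0"
  shows "(\<integral>u. indicator {-\<tau>..\<tau>} u * (u ^ (2 * k) * (\<tau>\<^sup>2 - u\<^sup>2) ^ M) \<partial>lborel)
    = 2 ^ Suc M * fact M * \<tau> ^ (2 * k + 2 * M + 1) / (\<Prod>i\<le>M. 2 * real k + 2 * real i + 1)"
proof (induction M arbitrary: k)
  case 0
  then show ?case using integral_even_power[OF assms, of k] by simp
next
  case (Suc M)
  let ?J = "\<lambda>k M. \<integral>u. indicator {-\<tau>..\<tau>} u * (u ^ (2 * k) * (\<tau>\<^sup>2 - u\<^sup>2) ^ M) \<partial>lborel"
  \<comment> \<open>The two products in the induction hypotheses share these \<open>M\<close>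
    factors; the first has an extra factor at the bottom, the second one at the top.\<close>
  define P where "P = (\<Prod>i<M. 2 * real k + 2 * real i + 3)"
  have P: "P > 0" unfolding P_def by (intro prod_pos) auto
  have p1: "(\<Prod>i\<le>M. 2 * real k + 2 * real i + 1) = (2 * real k + 1) * P"
    unfolding P_def lessThan_Suc_atMost[symmetric]
    by (subst prod.lessThan_Suc_shift) (simp add: algebra_simps)
  have p2: "(\<Prod>i\<le>M. 2 * real (Suc k) + 2 * real i + 1) = P * (2 * real k + 2 * real M + 3)"
    unfolding P_def lessThan_Suc_atMost[symmetric] by (simp add: algebra_simps)
  have p3: "(\<Prod>i\<le>Suc M. 2 * real k + 2 * real i + 1) = (2 * real k + 1) * P * (2 * real k + 2 * real M + 3)"
    using p1 by (simp add: algebra_simps)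
  have "?J k (Suc M) = (\<integral>u. \<tau>\<^sup>2 * (indicator {-\<tau>..\<tau>} u * (u ^ (2 * k) * (\<tau>\<^sup>2 - u\<^sup>2) ^ M))
      - indicator {-\<tau>..\<tau>} u * (u ^ (2 * Suc k) * (\<tau>\<^sup>2 - u\<^sup>2) ^ M) \<partial>lborel)"
    by (intro Bochner_Integration.integral_cong) (auto simp: algebra_simps power2_eq_square)
  also have "\<dots> = \<tau>\<^sup>2 * ?J k M - ?J (Suc k) M"
    by (subst Bochner_Integration.integral_diff)
      (auto intro!: integrable_mult_right integrable_Icc_continuous continuous_intros)
  also have "\<dots> = 2 ^ Suc M * fact M * \<tau> ^ (2 * k + 2 * Suc M + 1)
      * (1 / ((2 * real k + 1) * P) - 1 / (P * (2 * real k + 2 * real M + 3)))"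
    unfolding Suc.IH p1 p2 by (simp add: algebra_simps power2_eq_square)
  also have "1 / ((2 * real k + 1) * P) - 1 / (P * (2 * real k + 2 * real M + 3))
      = 2 * (real M + 1) / ((2 * real k + 1) * P * (2 * real k + 2 * real M + 3))"
    using P by (simp add: divide_simps add_nonneg_eq_0_iff)
  finally show ?case unfolding p3 by (simp add: algebra_simps)
qed

lemma legendre_cut_moment:
  "(\<integral>u. legendre_cut M u * u ^ (2 * j) \<partial>lborel)
    = (\<Sum>k\<le>M. legendre_coeff M k * (2 / (2 * real k + 2 * real j + 1)))"
proof -
  have "(\<integral>u. legendre_cut M u * u ^ (2 * j) \<partial>lborel)
      = (\<integral>u. (\<Sum>k\<le>M. legendre_coeff M k * (indicator {-1..1} u * u ^ (2 * (k + j)))) \<partial>lborel)"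
    by (intro Bochner_Integration.integral_cong)
      (auto simp: legendre_cut_def sum_distrib_left sum_distrib_right power_add algebra_simps)
  also have "\<dots> = (\<Sum>k\<le>M. legendre_coeff M k * (\<integral>u. indicator {-1..1} u * u ^ (2 * (k + j)) \<partial>lborel))"
    by (subst Bochner_Integration.integral_sum)
      (auto intro!: integrable_mult_right integrable_Icc_continuous continuous_intros)
  also have "\<dots> = (\<Sum>k\<le>M. legendre_coeff M k * (2 / (2 * real k + 2 * real j + 1)))"
    by (subst integral_even_power) auto
  finally show ?thesis .
qed

text \<open>Cancelling the denominator leaves the alternating binomial sum of a polynomial in
  \<open>k\<close> with at most \<open>M - 1\<close> linear factors, which vanishes.\<close>

lemma legendre_cut_moment_eq_0:
  assumes "j < M"
  shows "(\<integral>u. legendre_cut M u * u ^ (2 * j) \<partial>lborel) = 0"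
proof -
  define p :: "real poly" where "p = (\<Prod>i\<in>{..<M} - {j}. [:2 * real i + 1, 2:])"
  have "degree p \<le> (\<Sum>i\<in>{..<M} - {j}. 1)"
    unfolding p_def by (rule order.trans[OF degree_prod_sum_le]) auto
  then have deg: "degree p < M" using assms by simp
  have "legendre_coeff M k * (2 / (2 * real k + 2 * real j + 1))
      = 2 * ((-1) ^ k * real (M choose k) * poly p (real k))" for k
  proof -
    have "(\<Prod>i<M. 2 * real k + 2 * real i + 1) = (2 * real k + 2 * real j + 1) * poly p (real k)"
      unfolding p_def poly_prod using assms by (subst prod.remove[of _ j]) (auto simp: algebra_simps)
    moreover have "2 * real k + 2 * real j + 1 \<noteq> 0" by (metis of_nat_0_le_iff add_nonneg_pos less_irrefl mult_nonneg_nonneg zero_le_numeral zero_less_one add_nonneg_nonneg)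
    ultimately show ?thesis by (simp add: legendre_coeff_def)
  qed
  then show ?thesis
    unfolding legendre_cut_moment using alternating_binomial_sum_poly[OF deg]
    by (simp add: sum_distrib_left[symmetric])
qed

text \<open>In dimension \<open>2 * M + 1\<close> the weight beside \<open>legendre_cut\<close> is,
  up to a constant factor, the section volume of the ball of radius \<tau>.\<close>

definition radial_profile :: "nat \<Rightarrow> real \<Rightarrow> real" where
  "radial_profile M \<tau> = (\<integral>u. legendre_cut M u * (indicator {-\<tau>..\<tau>} u * (\<tau>\<^sup>2 - u\<^sup>2) ^ M) \<partial>lborel)"

text \<open>For \<tau> \<le> 1 the cut-off is inactive and each term is a Beta integral. The product
  in \<open>legendre_coeff\<close> cancels all of its denominator except the last factor.\<close>

lemma radial_profile_le_1:
  assumes "0 \<le> \<tau>" "\<tau> \<le> 1"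
  shows "radial_profile M \<tau> = 2 ^ Suc M * fact M
    * (\<Sum>k\<le>M. (-1) ^ k * real (M choose k) * (\<tau> ^ (2 * k + 2 * M + 1) / (2 * real k + 2 * real M + 1)))"
proof -
  have "radial_profile M \<tau>
      = (\<integral>u. (\<Sum>k\<le>M. legendre_coeff M k * (indicator {-\<tau>..\<tau>} u * (u ^ (2 * k) * (\<tau>\<^sup>2 - u\<^sup>2) ^ M))) \<partial>lborel)"
    unfolding radial_profile_def using assms
    by (intro Bochner_Integration.integral_cong)
      (auto simp: legendre_cut_def sum_distrib_left sum_distrib_right indicator_def algebra_simps)
  also have "\<dots> = (\<Sum>k\<le>M. legendre_coeff M k * (\<integral>u. indicator {-\<tau>..\<tau>} u * (u ^ (2 * k) * (\<tau>\<^sup>2 - u\<^sup>2) ^ M) \<partial>lborel))"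
    by (subst Bochner_Integration.integral_sum)
      (auto intro!: integrable_mult_right integrable_Icc_continuous continuous_intros)
  also have "\<dots> = (\<Sum>k\<le>M. 2 ^ Suc M * fact M
    * ((-1) ^ k * real (M choose k) * (\<tau> ^ (2 * k + 2 * M + 1) / (2 * real k + 2 * real M + 1))))"
  proof (rule sum.cong[OF refl])
    fix k
    have "(\<Prod>i<M. 2 * real k + 2 * real i + 1) > 0" by (intro prod_pos) (auto intro: add_nonneg_pos)
    then have "legendre_coeff M k * (x / (\<Prod>i\<le>M. 2 * real k + 2 * real i + 1))
      = (-1) ^ k * real (M choose k) * (x / (2 * real k + 2 * real M + 1))" for x
      unfolding lessThan_Suc_atMost[symmetric] legendre_coeff_def by simp
    then show "legendre_coeff M k * (\<integral>u. indicator {-\<tau>..\<tau>} u * (u ^ (2 * k) * (\<tau>\<^sup>2 - u\<^sup>2) ^ M) \<partial>lborel)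
      = 2 ^ Suc M * fact M * ((-1) ^ k * real (M choose k) * (\<tau> ^ (2 * k + 2 * M + 1) / (2 * real k + 2 * real M + 1)))"
      unfolding integral_even_beta[OF assms(1)] by simp
  qed
  finally show ?thesis by (simp only: sum_distrib_left)
qed

text \<open>Differentiation removes the denominators and leaves a binomial expansion: up to a
  positive constant the derivative is \<open>\<tau> ^ (2 * M) * (1 - \<tau>\<^sup>2) ^ M\<close>,
  positive on the open unit interval.\<close>

lemma radial_profile_strict_mono:
  assumes "0 \<le> s" "s < t" "t \<le> 1"
  shows "radial_profile M s < radial_profile M t"
proof -
  let ?f = "\<lambda>\<tau>::real. \<Sum>k\<le>M. (-1) ^ k * real (M choose k) * (\<tau> ^ (2 * k + 2 * M + 1) / (2 * real k + 2 * real M + 1))"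
  have D: "(?f has_real_derivative \<tau> ^ (2 * M) * (1 - \<tau>\<^sup>2) ^ M) (at \<tau>)" for \<tau>
  proof -
    have "((\<lambda>\<tau>. \<tau> ^ (2 * k + 2 * M + 1) / (2 * real k + 2 * real M + 1)) has_real_derivative \<tau> ^ (2 * M) * \<tau> ^ (2 * k)) (at \<tau>)" for k
    proof -
      have nz: "2 * real k + 2 * real M + 1 > 0" by simp
      have "((\<lambda>\<tau>. \<tau> ^ (2 * k + 2 * M + 1) / (2 * real k + 2 * real M + 1)) has_real_derivative
          real (2 * k + 2 * M + 1) * \<tau> ^ (2 * k + 2 * M) / (2 * real k + 2 * real M + 1)) (at \<tau>)"
        using DERIV_cdivide[OF DERIV_pow[of "2 * k + 2 * M + 1" \<tau>]] by simp
      moreover have "real (2 * k + 2 * M + 1) = 2 * real k + 2 * real M + 1" by simp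
      then have "real (2 * k + 2 * M + 1) * \<tau> ^ (2 * k + 2 * M) / (2 * real k + 2 * real M + 1) = \<tau> ^ (2 * M) * \<tau> ^ (2 * k)"
        using nz by (simp only:) (simp add: power_add)
      ultimately show ?thesis by simp
    qed
    then have "(?f has_real_derivative (\<Sum>k\<le>M. (-1) ^ k * real (M choose k) * (\<tau> ^ (2 * M) * \<tau> ^ (2 * k)))) (at \<tau>)"
      by (intro DERIV_sum DERIV_cmult) auto
    moreover have "(\<Sum>k\<le>M. (-1) ^ k * real (M choose k) * (\<tau> ^ (2 * M) * \<tau> ^ (2 * k))) = \<tau> ^ (2 * M) * (1 - \<tau>\<^sup>2) ^ M"
      using binomial_ring[of "- (\<tau>\<^sup>2)" 1 M]
      by (simp add: sum_distrib_left power_minus[of "\<tau>\<^sup>2"] power_mult[symmetric] algebra_simps)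
    ultimately show ?thesis by simp
  qed
  have "?f s < ?f t"
  proof (rule DERIV_pos_imp_increasing_open[OF assms(2)])
    fix x assume "s < x" "x < t"
    then have "0 < x" "x < 1" using assms by auto
    then have "x ^ (2 * M) * (1 - x\<^sup>2) ^ M > 0" by (simp add: power_less_one_iff)
    then show "\<exists>y. (?f has_real_derivative y) (at x) \<and> 0 < y" using D by blast
  next
    show "continuous_on {s..t} ?f" by (intro continuous_intros) auto
  qed
  then show ?thesis using assms by (simp add: radial_profile_le_1)
qed

text \<open>The annihilated moments leave only the top coefficient of \<open>(\<tau>\<^sup>2 - u\<^sup>2)\<^sup>M\<close>.\<close>

lemma radial_profile_ge_1:
  assumes "1 \<le> \<tau>"
  shows "radial_profile M \<tau> = radial_profile M 1"
proof -
  have "radial_profile M \<tau> = (-1) ^ M * (\<integral>u. legendre_cut M u * u ^ (2 * M) \<partial>lborel)" if "1 \<le> \<tau>" for \<tau>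
  proof -
    have "radial_profile M \<tau> = (\<integral>u. (\<Sum>j\<le>M. (-1) ^ j * real (M choose j) * (\<tau>\<^sup>2) ^ (M - j) * (legendre_cut M u * u ^ (2 * j))) \<partial>lborel)"
      unfolding radial_profile_def
    proof (intro Bochner_Integration.integral_cong refl)
      fix u
      have "(\<tau>\<^sup>2 - u\<^sup>2) ^ M = (\<Sum>j\<le>M. (-1) ^ j * real (M choose j) * (\<tau>\<^sup>2) ^ (M - j) * u ^ (2 * j))"
        using binomial_ring[of "- (u\<^sup>2)" "\<tau>\<^sup>2" M]
        by (simp add: power_minus[of "u\<^sup>2"] power_mult[symmetric] algebra_simps)
      \<comment> \<open>Since \<tau> \<ge> 1, the indicator of [-\<tau>, \<tau>] equals 1 on the
        support of \<open>legendre_cut\<close>.\<close>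
      moreover have cut: "legendre_cut M u * (indicator {-\<tau>..\<tau>} u * x) = legendre_cut M u * x" for x
        using that by (auto simp: legendre_cut_def indicator_def)
      ultimately show "legendre_cut M u * (indicator {-\<tau>..\<tau>} u * (\<tau>\<^sup>2 - u\<^sup>2) ^ M)
        = (\<Sum>j\<le>M. (-1) ^ j * real (M choose j) * (\<tau>\<^sup>2) ^ (M - j) * (legendre_cut M u * u ^ (2 * j)))"
        unfolding cut by (simp add: sum_distrib_left algebra_simps)
    qed
    also have "\<dots> = (\<Sum>j\<le>M. (-1) ^ j * real (M choose j) * (\<tau>\<^sup>2) ^ (M - j) * (\<integral>u. legendre_cut M u * u ^ (2 * j) \<partial>lborel))"
      by (subst Bochner_Integration.integral_sum)
        (auto intro!: integrable_mult_right integrable_legendre_cut_mult continuous_intros)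
    also have "\<dots> = (\<Sum>j\<in>{M}. (-1) ^ j * real (M choose j) * (\<tau>\<^sup>2) ^ (M - j) * (\<integral>u. legendre_cut M u * u ^ (2 * j) \<partial>lborel))"
      by (rule sum.mono_neutral_right) (auto simp: legendre_cut_moment_eq_0)
    finally show ?thesis by simp
  qed
  from this[OF assms] this[of 1] show ?thesis by simp
qed

text \<open>The profile increases strictly up to 1 and is constant afterwards. The factor 2 is the
  ratio of the radii of the shell used below.\<close>

lemma radial_profile_diff_pos:
  assumes "0 < \<rho>" "\<rho> < 1"
  shows "radial_profile M \<rho> < radial_profile M (2 * \<rho>)"
proof (cases "2 * \<rho> \<le> 1")
  case True
  then show ?thesis using assms by (intro radial_profile_strict_mono) auto
next
  case False
  then show ?thesis
    using assms radial_profile_strict_mono[of \<rho> 1 M] radial_profile_ge_1[of "2 * \<rho>" M] by simp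
qed

text \<open>Substitute \<open>u = \<rho> * t\<close>: the weight contributes \<open>2 * M\<close>
  powers of \<rho> and the differential one more.\<close>

lemma radial_profile_scale:
  assumes "\<rho> > 0"
  shows "(\<integral>t. legendre_cut M (\<rho> * t) * (indicator {-r..r} t * (r\<^sup>2 - t\<^sup>2) ^ M) \<partial>lborel)
    = radial_profile M (r * \<rho>) / \<rho> ^ (2 * M + 1)"
proof -
  have "radial_profile M (r * \<rho>) = \<rho> * (\<integral>t. legendre_cut M (\<rho> * t)
      * (indicator {-(r * \<rho>)..r * \<rho>} (\<rho> * t) * ((r * \<rho>)\<^sup>2 - (\<rho> * t)\<^sup>2) ^ M) \<partial>lborel)"
    unfolding radial_profile_def using assms
    by (subst lborel_integral_real_affine[where c=\<rho> and t=0]) simp_all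
  also have "(\<lambda>t. legendre_cut M (\<rho> * t) * (indicator {-(r * \<rho>)..r * \<rho>} (\<rho> * t) * ((r * \<rho>)\<^sup>2 - (\<rho> * t)\<^sup>2) ^ M))
    = (\<lambda>t. \<rho> ^ (2 * M) * (legendre_cut M (\<rho> * t) * (indicator {-r..r} t * (r\<^sup>2 - t\<^sup>2) ^ M)))"
  proof
    fix t
    have "(indicator {-(r * \<rho>)..r * \<rho>} (\<rho> * t) :: real) = indicator {-r..r} t"
      using assms mult_le_cancel_left_pos[of \<rho> t r] mult_le_cancel_left_pos[of \<rho> "-r" t]
      by (simp add: indicator_def mult.commute[of r])
    moreover have "((r * \<rho>)\<^sup>2 - (\<rho> * t)\<^sup>2) ^ M = \<rho> ^ (2 * M) * (r\<^sup>2 - t\<^sup>2) ^ M"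
    proof -
      have "(r * \<rho>)\<^sup>2 - (\<rho> * t)\<^sup>2 = \<rho>\<^sup>2 * (r\<^sup>2 - t\<^sup>2)"
        by (simp add: power_mult_distrib algebra_simps)
      then show ?thesis by (simp add: power_mult_distrib power_mult)
    qed
    ultimately show "legendre_cut M (\<rho> * t) * (indicator {-(r * \<rho>)..r * \<rho>} (\<rho> * t) * ((r * \<rho>)\<^sup>2 - (\<rho> * t)\<^sup>2) ^ M)
      = \<rho> ^ (2 * M) * (legendre_cut M (\<rho> * t) * (indicator {-r..r} t * (r\<^sup>2 - t\<^sup>2) ^ M))"
      by (simp add: algebra_simps)
  qed
  finally show ?thesis using assms by simp
qed

section \<open>A radial bump as a superposition of plane waves\<close>

text \<open>Removing the inner ball does two things: the profiles of the two balls cancel once both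
  have become constant, and \<open>norm y > 1\<close> keeps the hyperplanes in a wave of scale
  \<open>e\<close> within distance \<open>e\<close> of the centre.\<close>

definition shell :: "'a::euclidean_space set" where
  "shell = {y. 1 < norm y \<and> norm y \<le> 2}"

lemma shell_alt: "shell = cball 0 2 - cball 0 1"
  by (auto simp: shell_def)

lemma borel_shell [measurable]: "shell \<in> sets borel"
  by (simp add: shell_alt)

lemma bounded_shell: "bounded shell"
  unfolding shell_alt by (simp add: bounded_diff)

lemma section_volume_shell:
  fixes \<omega> :: "'a::euclidean_space"
  assumes dim: "DIM('a) = 2 * M + 1" and \<omega>: "norm \<omega> = 1" and t: "\<bar>t\<bar> \<noteq> 1" "\<bar>t\<bar> \<noteq> 2"
  shows "section_volume shell \<omega> t = unit_ball_vol (real (2 * M))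
    * (indicator {-2..2} t * (2\<^sup>2 - t\<^sup>2) ^ M - indicator {-1..1} t * (1\<^sup>2 - t\<^sup>2) ^ M)"
proof -
  let ?v = "\<lambda>r. unit_ball_vol (real (2 * M)) * (indicator {-r..r} t * (r\<^sup>2 - t\<^sup>2) ^ M)"
  let ?h = "hyperplane_lborel \<omega> t"
  have ball: "emeasure ?h (cball 0 r) = ennreal (?v r)" if "0 < r" "\<bar>t\<bar> \<noteq> r" for r
  proof (cases "\<bar>t\<bar> < r")
    case True
    then have "0 \<le> r\<^sup>2 - t\<^sup>2" using power_mono[of "\<bar>t\<bar>" r 2] by simp
    then have "sqrt (r\<^sup>2 - t\<^sup>2) ^ (2 * M) = (r\<^sup>2 - t\<^sup>2) ^ M" by (simp add: power_mult)
    then show ?thesis using emeasure_hyperplane_cball[OF \<omega> that] True by (simp add: dim indicator_def abs_less_iff)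
  next
    case False
    then show ?thesis using emeasure_hyperplane_cball[OF \<omega> that] that by (auto simp: indicator_def)
  qed
  have nonneg: "?v r \<ge> 0" if "0 < r" for r
  proof (cases "\<bar>t\<bar> \<le> r")
    case True
    then have "0 \<le> r\<^sup>2 - t\<^sup>2" using power_mono[of "\<bar>t\<bar>" r 2] by simp
    then show ?thesis by (intro mult_nonneg_nonneg zero_le_power) auto
  qed (auto simp: indicator_def)
  have b1: "emeasure ?h (cball 0 1) = ennreal (?v 1)" and b2: "emeasure ?h (cball 0 2) = ennreal (?v 2)"
    using ball[of 1] ball[of 2] t by auto
  \<comment> \<open>Subtraction in \<open>ennreal\<close> truncates at 0; inclusion of the balls
    shows that the real difference is nonnegative.\<close>
  have "ennreal (?v 1) \<le> ennreal (?v 2)"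
    unfolding b1[symmetric] b2[symmetric] by (intro emeasure_mono) auto
  then have le: "?v 1 \<le> ?v 2" using nonneg[of 2] by (simp add: ennreal_le_iff)
  have "ennreal (section_volume shell \<omega> t) = emeasure ?h shell"
    by (rule emeasure_hyperplane_bounded[OF \<omega> borel_shell bounded_shell, symmetric])
  also have "\<dots> = emeasure ?h (cball 0 2) - emeasure ?h (cball 0 1)"
    unfolding shell_alt by (rule emeasure_Diff) (auto simp: b1)
  also have "\<dots> = ennreal (?v 2 - ?v 1)"
    unfolding b1 b2 by (rule ennreal_minus) (rule nonneg, simp)
  finally have "section_volume shell \<omega> t = ?v 2 - ?v 1"
    using le by (subst (asm) ennreal_inj) (auto simp: section_volume_def)
  then show ?thesis by (simp only: right_diff_distrib)
qed

definition radial_bump :: "nat \<Rightarrow> 'a::euclidean_space \<Rightarrow> real" where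
  "radial_bump M z = (\<integral>y. indicator shell y * legendre_cut M (y \<bullet> z) \<partial>lborel)"

text \<open>With \<open>z = \<rho> *\<^sub>R \<omega>\<close> the wave depends on \<open>y\<close>
  only through \<open>\<omega> \<bullet> y\<close>, so slicing the shell orthogonally to \<omega>
  applies. The balls of radius 2 and 1 yield the profile at 2\<rho> and at \<rho>.\<close>

lemma radial_bump_eq:
  fixes z :: "'a::euclidean_space"
  assumes dim: "DIM('a) = 2 * M + 1" and "z \<noteq> 0"
  shows "radial_bump M z = unit_ball_vol (real (2 * M)) / norm z ^ (2 * M + 1)
    * (radial_profile M (2 * norm z) - radial_profile M (norm z))"
proof -
  let ?\<rho> = "norm z"
  let ?\<omega> = "z /\<^sub>R ?\<rho>"
  let ?v = "unit_ball_vol (real (2 * M))"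
  have \<rho>: "?\<rho> > 0" and \<omega>: "norm ?\<omega> = 1" using \<open>z \<noteq> 0\<close> by auto
  have int: "integrable lborel (\<lambda>t. legendre_cut M (?\<rho> * t) * (indicator {-r..r} t * (r\<^sup>2 - t\<^sup>2) ^ M))" for r
  proof (rule Bochner_Integration.integrable_bound)
    show "integrable lborel (\<lambda>t. (\<Sum>k\<le>M. \<bar>legendre_coeff M k\<bar>) * (indicator {-r..r} t * (r\<^sup>2 - t\<^sup>2) ^ M))"
      by (intro integrable_mult_right integrable_Icc_continuous continuous_intros)
    show "AE t in lborel. norm (legendre_cut M (?\<rho> * t) * (indicator {-r..r} t * (r\<^sup>2 - t\<^sup>2) ^ M))
      \<le> norm ((\<Sum>k\<le>M. \<bar>legendre_coeff M k\<bar>) * (indicator {-r..r} t * (r\<^sup>2 - t\<^sup>2) ^ M))"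
      by (rule AE_I2) (auto simp: abs_mult intro!: mult_right_mono order.trans[OF legendre_cut_bounded])
  qed measurable
  have "radial_bump M z = (\<integral>y. indicator shell y * legendre_cut M (?\<rho> * (?\<omega> \<bullet> y)) \<partial>lborel)"
    unfolding radial_bump_def using \<rho> by (simp add: inner_commute mult.assoc[symmetric])
  also have "\<dots> = (\<integral>t. section_volume shell ?\<omega> t * legendre_cut M (?\<rho> * t) \<partial>lborel)"
    by (rule integral_plane_wave[OF \<omega> borel_shell bounded_shell]) measurable
  also have "\<dots> = (\<integral>t. ?v * (legendre_cut M (?\<rho> * t) * (indicator {-2..2} t * (2\<^sup>2 - t\<^sup>2) ^ M)
      - legendre_cut M (?\<rho> * t) * (indicator {-1..1} t * (1\<^sup>2 - t\<^sup>2) ^ M)) \<partial>lborel)"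
  \<comment> \<open>The section formula omits the four values of \<open>t\<close> at which the
    hyperplane touches a sphere; they form a null set.\<close>
  proof (rule integral_cong_AE)
    show "AE t in lborel. section_volume shell ?\<omega> t * legendre_cut M (?\<rho> * t)
      = ?v * (legendre_cut M (?\<rho> * t) * (indicator {-2..2} t * (2\<^sup>2 - t\<^sup>2) ^ M)
      - legendre_cut M (?\<rho> * t) * (indicator {-1..1} t * (1\<^sup>2 - t\<^sup>2) ^ M))"
      using AE_lborel_singleton[of "1::real"] AE_lborel_singleton[of "-1::real"]
        AE_lborel_singleton[of "2::real"] AE_lborel_singleton[of "-2::real"]
    proof eventually_elim
      case (elim t)
      then have t: "\<bar>t\<bar> \<noteq> 1" "\<bar>t\<bar> \<noteq> 2" by auto
      show ?case
        unfolding section_volume_shell[OF dim \<omega> t] by (simp add: algebra_simps)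
    qed
    show "(\<lambda>t. section_volume shell ?\<omega> t * legendre_cut M (?\<rho> * t)) \<in> borel_measurable lborel"
      using borel_measurable_section_volume[OF \<omega> borel_shell bounded_shell] by measurable
  qed measurable
  also have "\<dots> = ?v * (radial_profile M (2 * ?\<rho>) / ?\<rho> ^ (2 * M + 1) - radial_profile M (1 * ?\<rho>) / ?\<rho> ^ (2 * M + 1))"
    using int[of 2] int[of 1] radial_profile_scale[OF \<rho>, of M 2] radial_profile_scale[OF \<rho>, of M 1]
    by (simp add: Bochner_Integration.integral_diff)
  finally show ?thesis by (simp add: diff_divide_distrib[symmetric])
qed

lemma radial_bump_pos:
  fixes z :: "'a::euclidean_space"
  assumes "DIM('a) = 2 * M + 1" "z \<noteq> 0" "norm z < 1"
  shows "radial_bump M z > 0"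
  using radial_profile_diff_pos[of "norm z" M] assms by (simp add: radial_bump_eq)

lemma radial_bump_eq_0:
  fixes z :: "'a::euclidean_space"
  assumes "DIM('a) = 2 * M + 1" "norm z \<ge> 1"
  shows "radial_bump M z = 0"
proof -
  have "z \<noteq> 0" using assms(2) by auto
  then show ?thesis
    using assms radial_profile_ge_1[of "norm z" M] radial_profile_ge_1[of "2 * norm z" M]
    by (simp add: radial_bump_eq)
qed

text \<open>Lagrange interpolation. The weights depend only on \<open>E\<close> and
  \<open>e\<close>, so one linear relation between scales serves for all polynomials of low degree
  and passes through integrals.\<close>

lemma lagrange_functional:
  fixes E :: "real set" and e :: real
  assumes "finite E"
  obtains w where "\<And>p. degree p < card E \<Longrightarrow> poly p e = (\<Sum>x\<in>E. w x * poly p x)"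
proof -
  define l where "l x = (\<Prod>y\<in>E - {x}. [:- y / (x - y), 1 / (x - y):])" for x
  have l: "poly (l x) y = (if x = y then 1 else 0)" if "x \<in> E" "y \<in> E" for x y
  proof (cases "x = y")
    case True
    have "poly (l x) x = (\<Prod>y\<in>E - {x}. 1)"
      unfolding l_def poly_prod
    proof (rule prod.cong[OF refl])
      fix y assume "y \<in> E - {x}"
      then have "x - y \<noteq> 0" by auto
      then show "poly [:- y / (x - y), 1 / (x - y):] x = 1" by (simp flip: diff_divide_distrib)
    qed
    then show ?thesis using True by simp
  next
    case False
    then show ?thesis
      unfolding l_def poly_prod using assms that by (auto simp: field_simps)
  qed
  have deg: "degree (l x) < card E" if "x \<in> E" for x
  proof -
    have "degree (l x) \<le> (\<Sum>y\<in>E - {x}. 1)"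
      unfolding l_def by (rule order.trans[OF degree_prod_sum_le]) (auto simp: assms)
    moreover have "card E > 0" using that assms card_gt_0_iff by blast
    ultimately show ?thesis using that by simp
  qed
  have "poly p e = (\<Sum>x\<in>E. poly (l x) e * poly p x)" if p: "degree p < card E" for p
  proof -
    let ?q = "\<Sum>x\<in>E. smult (poly p x) (l x)"
    have "degree ?q < card E"
      using p by (intro degree_sum_less) (auto intro: le_less_trans[OF degree_smult_le] deg)
    moreover have "poly p y = poly ?q y" if "y \<in> E" for y
      using assms that by (simp add: poly_sum l if_distrib cong: if_cong sum.cong)
    ultimately have "p = ?q" using p by (intro poly_eqI_degree[of E]) auto
    then have "poly p e = poly ?q e" by simp
    then show ?thesis by (simp add: poly_sum mult.commute)
  qed
  then show ?thesis using that[of "\<lambda>x. poly (l x) e"] by blast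
qed

section \<open>Integrals of the rescaled bump\<close>

lemma norm_scaleR_inverse:
  fixes x :: "'a::real_normed_vector"
  shows "e > 0 \<Longrightarrow> norm (x /\<^sub>R e) = norm x / e"
  by (simp add: divide_inverse mult.commute)

lemma radial_bump_nonneg:
  fixes z :: "'a::euclidean_space"
  assumes "DIM('a) = 2 * M + 1" "z \<noteq> 0"
  shows "radial_bump M z \<ge> 0"
  using radial_bump_pos[OF assms] radial_bump_eq_0[OF assms(1), of z] by fastforce

lemma borel_measurable_radial_bump [measurable]:
  "radial_bump M \<in> borel_measurable (borel :: 'a::euclidean_space measure)"
  unfolding radial_bump_def[abs_def] by measurable

text \<open>Fubini on \<open>A \<times> shell\<close>: the integrand is bounded and lives on a set
  of finite measure.\<close>

lemma
  fixes A :: "'a::euclidean_space set"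
  assumes [measurable]: "A \<in> sets borel" and "bounded A"
  shows integrable_radial_bump_indicator:
      "integrable lborel (\<lambda>x. indicator A x * radial_bump M ((x - x0) /\<^sub>R e))"
    and integral_radial_bump_indicator:
      "(\<integral>x. indicator A x * radial_bump M ((x - x0) /\<^sub>R e) \<partial>lborel)
        = (\<integral>y. indicator shell y * (\<integral>x. indicator A x * legendre_cut M (y \<bullet> ((x - x0) /\<^sub>R e)) \<partial>lborel) \<partial>lborel)"
    and integrable_shell_waves:
      "integrable lborel (\<lambda>y. indicator shell y * (\<integral>x. indicator A x * legendre_cut M (y \<bullet> ((x - x0) /\<^sub>R e)) \<partial>lborel))"
proof -
  let ?F = "\<lambda>x y. indicator A x * (indicator shell y * legendre_cut M (y \<bullet> ((x - x0) /\<^sub>R e)))"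
  let ?K = "\<Sum>k\<le>M. \<bar>legendre_coeff M k\<bar>"
  have fin: "emeasure lborel A < \<infinity>" "emeasure lborel (shell :: 'a set) < \<infinity>"
    using emeasure_bounded_finite[OF \<open>bounded A\<close>] emeasure_bounded_finite[OF bounded_shell] by auto
  have "integrable (lborel \<Otimes>\<^sub>M lborel) (\<lambda>(x, y). ?F x y)"
  proof (rule Bochner_Integration.integrable_bound)
    have "emeasure (lborel \<Otimes>\<^sub>M lborel) (A \<times> (shell :: 'a set)) < \<infinity>"
      using fin by (subst lborel.emeasure_pair_measure_Times) (auto simp: ennreal_mult_less_top)
    then show "integrable (lborel \<Otimes>\<^sub>M lborel) (\<lambda>p. ?K * indicator (A \<times> (shell :: 'a set)) p)"
      by (intro integrable_mult_right integrable_real_indicator) auto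
    show "AE p in lborel \<Otimes>\<^sub>M lborel. norm (case p of (x, y) \<Rightarrow> ?F x y) \<le> norm (?K * indicator (A \<times> (shell :: 'a set)) p)"
      using legendre_cut_bounded[of M]
      by (intro AE_I2) (auto simp: indicator_def sum_nonneg)
  qed measurable
  then have int: "integrable (lborel \<Otimes>\<^sub>M lborel) (case_prod ?F)" by simp
  have x: "(\<integral>y. ?F x y \<partial>lborel) = indicator A x * radial_bump M ((x - x0) /\<^sub>R e)" for x
    by (simp add: radial_bump_def)
  have y: "(\<integral>x. ?F x y \<partial>lborel) = indicator shell y * (\<integral>x. indicator A x * legendre_cut M (y \<bullet> ((x - x0) /\<^sub>R e)) \<partial>lborel)" for y
    by (subst integral_mult_right_zero[symmetric]) (simp only: mult.left_commute)
  show "integrable lborel (\<lambda>x. indicator A x * radial_bump M ((x - x0) /\<^sub>R e))"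
    using lborel_pair.integrable_fst'[OF int] by (simp only: prod.case x)
  show "integrable lborel (\<lambda>y. indicator shell y * (\<integral>x. indicator A x * legendre_cut M (y \<bullet> ((x - x0) /\<^sub>R e)) \<partial>lborel))"
    using lborel_pair.integrable_snd[OF int] by (simp only: y)
  show "(\<integral>x. indicator A x * radial_bump M ((x - x0) /\<^sub>R e) \<partial>lborel)
        = (\<integral>y. indicator shell y * (\<integral>x. indicator A x * legendre_cut M (y \<bullet> ((x - x0) /\<^sub>R e)) \<partial>lborel) \<partial>lborel)"
    using lborel_pair.Fubini_integral[OF int] by (simp only: x y)
qed

text \<open>The rescaled bump vanishes outside \<open>cball x0 e\<close>, so integrability on
  bounded sets suffices. The power of \<open>e\<close> is the Jacobian of
  \<open>x0 + e *\<^sub>R x\<close>.\<close>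

lemma
  fixes x0 :: "'a::euclidean_space"
  assumes dim: "DIM('a) = 2 * M + 1" and e: "e > 0"
  shows integrable_radial_bump: "integrable lborel (\<lambda>x. radial_bump M ((x - x0) /\<^sub>R e))"
    and integral_radial_bump_scale:
      "(\<integral>x. radial_bump M ((x - x0) /\<^sub>R e) \<partial>lborel) = e ^ DIM('a) * (\<integral>x. radial_bump M (x :: 'a) \<partial>lborel)"
proof -
  have restrict: "indicator (cball x0 e) x * radial_bump M ((x - x0) /\<^sub>R e) = radial_bump M ((x - x0) /\<^sub>R e)" for x
  proof (cases "x \<in> cball x0 e")
    case False
    then have "norm ((x - x0) /\<^sub>R e) \<ge> 1" using e by (simp add: dist_norm norm_minus_commute norm_scaleR_inverse del: norm_scaleR)
    then show ?thesis by (simp add: radial_bump_eq_0[OF dim])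
  qed simp
  show "integrable lborel (\<lambda>x. radial_bump M ((x - x0) /\<^sub>R e))"
    using integrable_radial_bump_indicator[of "cball x0 e" M e x0] unfolding restrict by simp
  have "(\<integral>x. radial_bump M ((x - x0) /\<^sub>R e) \<partial>lborel)
      = (\<integral>x. radial_bump M ((x - x0) /\<^sub>R e) \<partial>density (distr lborel borel (\<lambda>x. x0 + e *\<^sub>R x)) (\<lambda>_. ennreal (\<bar>e\<bar> ^ DIM('a))))"
    using e by (subst lborel_affine[of e x0]) (auto simp: ennreal_power)
  also have "\<dots> = e ^ DIM('a) * (\<integral>x. radial_bump M (x :: 'a) \<partial>lborel)"
    using e by (simp add: integral_density integral_distr)
  finally show "(\<integral>x. radial_bump M ((x - x0) /\<^sub>R e) \<partial>lborel) = e ^ DIM('a) * (\<integral>x. radial_bump M (x :: 'a) \<partial>lborel)" .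
qed

section \<open>Extrapolation from small scales to all scales below \<delta>\<close>

lemma hyperplane_meets_connected:
  fixes D :: "'a::euclidean_space set"
  assumes "connected D" and "x \<in> convex hull D"
  shows "D \<inter> {z. \<omega> \<bullet> z = \<omega> \<bullet> x} \<noteq> {}"
proof
  assume *: "D \<inter> {z. \<omega> \<bullet> z = \<omega> \<bullet> x} = {}"
  \<comment> \<open>A connected set missing the hyperplane lies in one open half-space; that
    half-space is convex, so it contains the hull and \<open>x\<close> as well.\<close>
  have "D \<subseteq> {z. \<omega> \<bullet> z < \<omega> \<bullet> x} \<or> D \<subseteq> {z. \<omega> \<bullet> z > \<omega> \<bullet> x}"
  proof (rule ccontr)
    assume "\<not> ?thesis"
    then obtain u v where "u \<in> D" "\<omega> \<bullet> u \<ge> \<omega> \<bullet> x" "v \<in> D" "\<omega> \<bullet> v \<le> \<omega> \<bullet> x" by force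
    then obtain z where "z \<in> D" "\<omega> \<bullet> z = \<omega> \<bullet> x"
      using connected_ivt_hyperplane[OF assms(1), of v u \<omega> "\<omega> \<bullet> x"] by auto
    then show False using * by auto
  qed
  then have "convex hull D \<subseteq> {z. \<omega> \<bullet> z < \<omega> \<bullet> x} \<or> convex hull D \<subseteq> {z. \<omega> \<bullet> z > \<omega> \<bullet> x}"
    by (metis hull_minimal convex_halfspace_lt convex_halfspace_gt)
  then show False using assms(2) by auto
qed

text \<open>The hyperplanes involved stay inside the range where the section volume is polynomial, so
  the plane-wave integral is a polynomial in the scale \<open>e\<close>. The statement in terms of
  \<open>w\<close> says so without naming its coefficients, and it survives integration over \<open>y\<close>.\<close>

lemma plane_wave_interpolation:
  fixes D :: "'a::euclidean_space set"
  assumes D: "domain_in D" "bounded D"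
    and poly: "\<And>\<omega> t. \<omega> \<in> sphere 0 1 \<Longrightarrow> D \<inter> {x. \<omega> \<bullet> x = t} \<noteq> {} \<Longrightarrow>
      section_volume D \<omega> t = (\<Sum>j\<le>N. a j \<omega> * t ^ j)"
    and hull: "ball x0 \<delta> \<subseteq> convex hull D"
    and y: "norm y > 1"
    and e: "0 < e" "e < \<delta>" and E: "finite E" "E \<subseteq> {0<..<\<delta>}"
    and w: "\<And>p. degree p \<le> N + 1 \<Longrightarrow> poly p e = (\<Sum>x\<in>E. w x * poly p x)"
  shows "(\<integral>x. indicator D x * legendre_cut M (y \<bullet> ((x - x0) /\<^sub>R e)) \<partial>lborel)
    = (\<Sum>s\<in>E. w s * (\<integral>x. indicator D x * legendre_cut M (y \<bullet> ((x - x0) /\<^sub>R s)) \<partial>lborel))"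
proof -
  have con: "connected D" and [measurable]: "D \<in> sets borel"
    using D(1) by (auto simp: domain_in_def)
  define r where "r = norm y"
  define \<omega> where "\<omega> = y /\<^sub>R r"
  define t0 where "t0 = \<omega> \<bullet> x0"
  have r: "r > 1" using y by (simp add: r_def)
  have \<omega>: "norm \<omega> = 1" and y_eq: "y = r *\<^sub>R \<omega>" using r unfolding \<omega>_def by (auto simp: r_def[symmetric])
  \<comment> \<open>For fixed \<open>s\<close> this is a polynomial in the scale \<epsilon>: the
    section volume at \<open>t0 + \<epsilon> * (s / r)\<close> times the factor \<epsilon> from the
    change of variables. That factor raises the degree bound to \<open>N + 1\<close>.\<close>
  define P where "P s = [:0, 1:] * (\<Sum>j\<le>N. smult (a j \<omega>) ([:t0, s / r:] ^ j))" for s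
  have poly_P: "poly (P s) \<epsilon> = \<epsilon> * (\<Sum>j\<le>N. a j \<omega> * (t0 + \<epsilon> * (s / r)) ^ j)" for s \<epsilon>
    by (simp add: P_def poly_sum)
  have deg: "degree (P s) \<le> N + 1" for s
  proof -
    have "degree ([:t0, s / r:] ^ j) \<le> N" if "j \<le> N" for j
    proof -
      have "degree ([:t0, s / r:] ^ j) \<le> degree [:t0, s / r:] * j" by (rule degree_power_le)
      also have "\<dots> \<le> 1 * j" by (intro mult_right_mono) auto
      finally show ?thesis using that by simp
    qed
    then have "degree (\<Sum>j\<le>N. smult (a j \<omega>) ([:t0, s / r:] ^ j)) \<le> N"
      by (intro degree_sum_le) (auto intro: order.trans[OF degree_smult_le])
    moreover have "degree (P s) \<le> degree [:0, 1::real:] + degree (\<Sum>j\<le>N. smult (a j \<omega>) ([:t0, s / r:] ^ j))"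
      unfolding P_def by (rule degree_mult_le)
    ultimately show ?thesis by simp
  qed
  have wave: "(\<integral>x. indicator D x * legendre_cut M (y \<bullet> ((x - x0) /\<^sub>R \<epsilon>)) \<partial>lborel)
      = (\<integral>s. legendre_cut M s * poly (P s) \<epsilon> \<partial>lborel) / r" if \<epsilon>: "0 < \<epsilon>" "\<epsilon> < \<delta>" for \<epsilon>
  proof -
    have "(\<integral>x. indicator D x * legendre_cut M (y \<bullet> ((x - x0) /\<^sub>R \<epsilon>)) \<partial>lborel)
        = (\<integral>x. indicator D x * legendre_cut M (r * (\<omega> \<bullet> x - t0) / \<epsilon>) \<partial>lborel)"
      by (intro Bochner_Integration.integral_cong) (auto simp: y_eq t0_def inner_diff_right divide_inverse algebra_simps)
    also have "\<dots> = (\<integral>t. section_volume D \<omega> t * legendre_cut M (r * (t - t0) / \<epsilon>) \<partial>lborel)"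
      by (rule integral_plane_wave[OF \<omega> _ D(2)]) measurable
    also have "\<dots> = \<bar>\<epsilon> / r\<bar> *\<^sub>R (\<integral>s. section_volume D \<omega> (t0 + \<epsilon> / r * s)
        * legendre_cut M (r * (t0 + \<epsilon> / r * s - t0) / \<epsilon>) \<partial>lborel)"
      using \<epsilon> r by (intro lborel_integral_real_affine) simp
    also have "\<dots> = \<epsilon> / r * (\<integral>s. (\<Sum>j\<le>N. a j \<omega> * (t0 + \<epsilon> * (s / r)) ^ j) * legendre_cut M s \<partial>lborel)"
    proof -
      have inside: "section_volume D \<omega> (t0 + \<epsilon> / r * s) * legendre_cut M (r * (t0 + \<epsilon> / r * s - t0) / \<epsilon>)
        = (\<Sum>j\<le>N. a j \<omega> * (t0 + \<epsilon> * (s / r)) ^ j) * legendre_cut M s" for s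
      proof (cases "\<bar>s\<bar> \<le> 1")
        case True
        have "\<epsilon> / r * \<bar>s\<bar> \<le> \<epsilon> / r * 1" using True \<epsilon> r by (intro mult_left_mono) auto
        also have "\<dots> \<le> \<epsilon>" using \<epsilon> r by (simp add: field_simps)
        finally have "\<epsilon> / r * \<bar>s\<bar> < \<delta>" using \<epsilon> by simp
        \<comment> \<open>This point lies on the hyperplane in question; being in the hull, it
          forces the hyperplane to meet \<open>D\<close>, so the polynomial formula applies.\<close>
        then have "x0 + (\<epsilon> / r * s) *\<^sub>R \<omega> \<in> ball x0 \<delta>"
          using \<epsilon> r \<omega> by (simp add: dist_norm abs_mult)
        then have "x0 + (\<epsilon> / r * s) *\<^sub>R \<omega> \<in> convex hull D" using hull by blast
        from hyperplane_meets_connected[OF con this, of \<omega>]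
        have "D \<inter> {x. \<omega> \<bullet> x = t0 + \<epsilon> / r * s} \<noteq> {}"
          using \<omega> by (simp add: inner_add_right t0_def norm_eq_1)
        then show ?thesis using poly[of \<omega>] \<omega> \<epsilon> r by simp
      next
        case False
        then show ?thesis using \<epsilon> r by (simp add: legendre_cut_eq_0)
      qed
      show ?thesis unfolding inside using \<epsilon> r by simp
    qed
    also have "\<dots> = (\<integral>s. \<epsilon> * ((\<Sum>j\<le>N. a j \<omega> * (t0 + \<epsilon> * (s / r)) ^ j) * legendre_cut M s) \<partial>lborel) / r"
      by simp
    finally show ?thesis unfolding poly_P by (simp add: mult_ac)
  qed
  have int: "integrable lborel (\<lambda>s. legendre_cut M s * poly (P s) \<epsilon>)" for \<epsilon>
    unfolding poly_P using r by (intro integrable_legendre_cut_mult continuous_intros) auto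
  have "(\<integral>s. legendre_cut M s * poly (P s) e \<partial>lborel)
      = (\<integral>s. (\<Sum>\<epsilon>\<in>E. w \<epsilon> * (legendre_cut M s * poly (P s) \<epsilon>)) \<partial>lborel)"
    by (simp add: w[OF deg] sum_distrib_left mult.left_commute)
  also have "\<dots> = (\<Sum>\<epsilon>\<in>E. w \<epsilon> * (\<integral>s. legendre_cut M s * poly (P s) \<epsilon> \<partial>lborel))"
    using int by (subst Bochner_Integration.integral_sum) auto
  finally have J: "(\<integral>s. legendre_cut M s * poly (P s) e \<partial>lborel)
      = (\<Sum>\<epsilon>\<in>E. w \<epsilon> * (\<integral>s. legendre_cut M s * poly (P s) \<epsilon> \<partial>lborel))" .
  have "(\<Sum>s\<in>E. w s * (\<integral>x. indicator D x * legendre_cut M (y \<bullet> ((x - x0) /\<^sub>R s)) \<partial>lborel))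
      = (\<Sum>\<epsilon>\<in>E. w \<epsilon> * ((\<integral>s. legendre_cut M s * poly (P s) \<epsilon> \<partial>lborel) / r))"
  proof (rule sum.cong[OF refl])
    fix s assume "s \<in> E"
    then have "0 < s" "s < \<delta>" using E(2) by auto
    then show "w s * (\<integral>x. indicator D x * legendre_cut M (y \<bullet> ((x - x0) /\<^sub>R s)) \<partial>lborel)
      = w s * ((\<integral>t. legendre_cut M t * poly (P t) s \<partial>lborel) / r)"
      by (simp only: wave)
  qed
  then show ?thesis
    by (simp only: wave[OF e] J sum_divide_distrib times_divide_eq_right)
qed

text \<open>At scales so small that the bump is supported in \<open>D\<close>, its integral over
  \<open>D\<close> is its full integral. Interpolation carries this equality to the scale
  \<open>e\<close>, so a nonnegative function has zero integral off \<open>D\<close>.\<close>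

lemma AE_ball_in_domain:
  fixes D :: "'a::euclidean_space set"
  assumes D: "domain_in D" "bounded D" "polynomially_integrable D"
    and dim: "DIM('a) = 2 * M + 1"
    and x0: "x0 \<in> D" and hull: "ball x0 \<delta> \<subseteq> convex hull D" and e: "0 < e" "e < \<delta>"
  shows "AE x in lborel. x \<in> ball x0 e \<longrightarrow> x \<in> D"
proof -
  have "open D" and [measurable]: "D \<in> sets borel" using D(1) by (auto simp: domain_in_def)
  obtain N a where poly: "\<And>\<omega> t. \<omega> \<in> sphere 0 1 \<Longrightarrow> D \<inter> {x. \<omega> \<bullet> x = t} \<noteq> {} \<Longrightarrow>
      section_volume D \<omega> t = (\<Sum>j\<le>N. a j \<omega> * t ^ j)"
    using D(3) unfolding polynomially_integrable_def by blast
  obtain \<eta>0 where \<eta>0: "\<eta>0 > 0" "ball x0 \<eta>0 \<subseteq> D"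
    using \<open>open D\<close> x0 open_contains_ball by blast
  \<comment> \<open>Below \<eta> the nodes are admissible for the interpolation of waves, and the
    bumps around \<open>x0\<close> are supported in \<open>D\<close>.\<close>
  define \<eta> where "\<eta> = min \<eta>0 \<delta>"
  have \<eta>: "\<eta> > 0" "\<eta> \<le> \<delta>" "ball x0 \<eta> \<subseteq> D" using \<eta>0 e by (auto simp: \<eta>_def)
  have "infinite {0<..<\<eta>}" using \<eta>(1) by simp
  \<comment> \<open>The number of nodes exceeds both degrees to be interpolated:
    \<open>N + 1\<close> for the waves and \<open>2 * M + 1\<close> for the power of the
    scale.\<close>
  then obtain E where E: "finite E" "card E = N + 2 * M + 3" "E \<subseteq> {0<..<\<eta>}"
    using infinite_arbitrarily_large by blast
  obtain w where w: "\<And>p. degree p < card E \<Longrightarrow> poly p e = (\<Sum>x\<in>E. w x * poly p x)"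
    using lagrange_functional[OF E(1)] by blast
  let ?b = "\<lambda>s x. radial_bump M ((x - x0) /\<^sub>R s)"
  let ?G = "\<lambda>s. \<integral>x. indicator D x * ?b s x \<partial>lborel"
  let ?W = "\<lambda>s y. \<integral>x. indicator D x * legendre_cut M (y \<bullet> ((x - x0) /\<^sub>R s)) \<partial>lborel"
  have "?G e = (\<integral>y. indicator shell y * ?W e y \<partial>lborel)"
    by (rule integral_radial_bump_indicator) (use D in auto)
  also have "\<dots> = (\<integral>y. (\<Sum>s\<in>E. w s * (indicator shell y * ?W s y)) \<partial>lborel)"
  proof (intro Bochner_Integration.integral_cong refl)
    fix y :: 'a
    show "indicator shell y * ?W e y = (\<Sum>s\<in>E. w s * (indicator shell y * ?W s y))"
    proof (cases "y \<in> shell")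
      case True
      then have "norm y > 1" by (simp add: shell_def)
      then have "?W e y = (\<Sum>s\<in>E. w s * ?W s y)"
        using E \<eta>(2) w by (intro plane_wave_interpolation[OF D(1,2) poly hull _ e]) auto
      then show ?thesis using True by simp
    qed simp
  qed
  also have "\<dots> = (\<Sum>s\<in>E. w s * (\<integral>y. indicator shell y * ?W s y \<partial>lborel))"
    using integrable_shell_waves[of D M _ x0] D(2) by (subst Bochner_Integration.integral_sum) auto
  also have "\<dots> = (\<Sum>s\<in>E. w s * ?G s)"
    by (subst integral_radial_bump_indicator) (use D in auto)
  also have "\<dots> = (\<Sum>s\<in>E. w s * s ^ DIM('a)) * (\<integral>x. radial_bump M (x :: 'a) \<partial>lborel)"
  proof -
    have "?G s = s ^ DIM('a) * (\<integral>x. radial_bump M (x :: 'a) \<partial>lborel)" if "s \<in> E" for s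
    proof -
      have s: "0 < s" "s < \<eta>" using E(3) that by auto
      have restrict: "indicator D x * ?b s x = ?b s x" for x
      proof (cases "x \<in> D")
        case False
        then have "norm (x - x0) \<ge> \<eta>"
          using \<eta>(3) by (force simp: dist_norm norm_minus_commute)
        then have "norm ((x - x0) /\<^sub>R s) \<ge> 1" using s by (simp add: norm_scaleR_inverse del: norm_scaleR)
        then show ?thesis by (simp add: radial_bump_eq_0[OF dim])
      qed simp
      show ?thesis unfolding restrict by (rule integral_radial_bump_scale[OF dim s(1)])
    qed
    then show ?thesis by (simp add: sum_distrib_right mult.assoc)
  qed
  \<comment> \<open>The same weights reproduce the monomial of degree \<open>DIM('a)\<close>, which
    turns the values at the nodes into the full integral at scale \<open>e\<close>.\<close>
  also have "(\<Sum>s\<in>E. w s * s ^ DIM('a)) = e ^ DIM('a)"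
    using w[of "monom 1 (DIM('a))"] E(2) dim by (simp add: poly_monom degree_monom_eq)
  finally have "?G e = (\<integral>x. ?b e x \<partial>lborel)"
    using integral_radial_bump_scale[OF dim e(1), of x0] by simp
  then have "(\<integral>x. ?b e x - indicator D x * ?b e x \<partial>lborel) = 0"
    using integrable_radial_bump[OF dim e(1), of x0] integrable_radial_bump_indicator[of D M e x0] D(2)
    by (subst Bochner_Integration.integral_diff) auto
  moreover have "AE x in lborel. 0 \<le> ?b e x - indicator D x * ?b e x"
    using AE_lborel_singleton[of x0]
  proof eventually_elim
    case (elim x)
    then have "?b e x \<ge> 0" using e by (intro radial_bump_nonneg[OF dim]) auto
    then show ?case by (auto simp: indicator_def)
  qed
  ultimately have "AE x in lborel. ?b e x - indicator D x * ?b e x = 0"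
    using integrable_radial_bump[OF dim e(1), of x0] integrable_radial_bump_indicator[of D M e x0] D(2)
    by (subst integral_nonneg_eq_0_iff_AE[symmetric]) auto
  then show ?thesis
  proof eventually_elim
    case (elim x)
    show ?case
    proof (rule impI, rule ccontr)
      assume x: "x \<in> ball x0 e" "x \<notin> D"
      then have "(x - x0) /\<^sub>R e \<noteq> 0" using x0 e by auto
      moreover have "norm ((x - x0) /\<^sub>R e) < 1"
        using x e by (simp add: dist_norm norm_minus_commute norm_scaleR_inverse del: norm_scaleR)
      ultimately have "?b e x > 0" by (rule radial_bump_pos[OF dim])
      then show False using elim x by simp
    qed
  qed
qed

section \<open>Convexity\<close>

lemma AE_open_imp_nonempty_Int:
  fixes U :: "'a::euclidean_space set"
  assumes "open U" "U \<noteq> {}" and ae: "AE x in lborel. x \<in> U \<longrightarrow> P x"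
  shows "\<exists>x\<in>U. P x"
proof (rule ccontr)
  assume "\<not> ?thesis"
  then have "AE x in lborel. x \<notin> U" using ae by auto
  then have "emeasure lborel U = 0"
    using \<open>open U\<close> by (subst (asm) AE_iff_measurable[where N=U]) auto
  moreover obtain x r where "r > 0" "ball x r \<subseteq> U" using assms(1,2) open_contains_ball by blast
  then have "emeasure lborel (ball x r) \<le> emeasure lborel U"
    using \<open>open U\<close> by (intro emeasure_mono) auto
  moreover have "emeasure lborel (ball x r) > 0"
    using \<open>r > 0\<close> unit_ball_vol_pos[of "DIM('a)"] by (simp add: emeasure_ball)
  ultimately show False by simp
qed

text \<open>A smooth domain has exterior points near each boundary point, so it cannot omit
  only a null set.\<close>

lemma smooth_boundary_AE_imp_subset:
  fixes D :: "'a::euclidean_space set"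
  assumes "open D" "smooth_boundary D" "open U" and ae: "AE x in lborel. x \<in> U \<longrightarrow> x \<in> D"
  shows "U \<subseteq> D"
proof
  fix p assume "p \<in> U"
  show "p \<in> D"
  proof (rule ccontr)
    assume "p \<notin> D"
    have "p \<in> closure D"
      unfolding closure_iff_nhds_not_empty
    proof (intro allI impI notI)
      fix A V assume "V \<subseteq> A" "open V" "p \<in> V" "D \<inter> A = {}"
      moreover have "\<exists>x\<in>V \<inter> U. x \<in> D"
        using \<open>open V\<close> \<open>p \<in> V\<close> \<open>p \<in> U\<close> assms(3) ae by (intro AE_open_imp_nonempty_Int) auto
      ultimately show False by blast
    qed
    then have "p \<in> frontier D"
      using \<open>p \<notin> D\<close> \<open>open D\<close> by (simp add: frontier_def interior_open)
    then obtain V \<rho> where V: "open V" "p \<in> V" and sm: "smooth_on V \<rho>"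
      and d: "frechet_derivative \<rho> (at p) \<noteq> (\<lambda>v. 0)" and DV: "D \<inter> V = {x\<in>V. \<rho> x < 0}"
      using \<open>smooth_boundary D\<close> unfolding smooth_boundary_def by blast
    have diff: "\<rho> differentiable (at x)" if "x \<in> V" for x
      using sm that unfolding smooth_on_def by (metis Ck_on.simps(2))
    have cont: "continuous_on V \<rho>"
      using sm unfolding smooth_on_def by (metis Ck_on.simps(1))
    \<comment> \<open>Points with \<rho> > 0 would form a nonempty open subset of \<open>U\<close>
      disjoint from \<open>D\<close>, contradicting \<open>ae\<close>.\<close>
    have no_pos: "\<rho> x \<le> 0" if "x \<in> U \<inter> V" for x
    proof (rule ccontr)
      assume "\<not> \<rho> x \<le> 0"
      have "open {x\<in>U \<inter> V. \<rho> x > 0}"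
      proof -
        have "open (V \<inter> \<rho> -` {0<..})" using cont V(1) by (auto simp: continuous_on_open_vimage Int_commute)
        moreover have "{x\<in>U \<inter> V. \<rho> x > 0} = U \<inter> (V \<inter> \<rho> -` {0<..})" by auto
        ultimately show ?thesis using assms(3) by (simp add: open_Int)
      qed
      then have "\<exists>x\<in>{x\<in>U \<inter> V. \<rho> x > 0}. x \<in> D"
        using that \<open>\<not> \<rho> x \<le> 0\<close> ae by (intro AE_open_imp_nonempty_Int) auto
      then show False using DV by force
    qed
    have "\<rho> p = 0" using no_pos[of p] \<open>p \<in> U\<close> \<open>p \<in> V\<close> \<open>p \<notin> D\<close> DV by force
    obtain \<epsilon> where \<epsilon>: "\<epsilon> > 0" "ball p \<epsilon> \<subseteq> U \<inter> V"
      using assms(3) V \<open>p \<in> U\<close> by (meson IntI open_Int open_contains_ball)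
    \<comment> \<open>Now \<rho> has a local maximum at \<open>p\<close>, so its differential
      vanishes there, against the choice of a defining function.\<close>
    have "frechet_derivative \<rho> (at p) = (\<lambda>v. 0)"
    proof (rule differential_zero_maxmin[of p "ball p \<epsilon>" \<rho>])
      show "(\<rho> has_derivative frechet_derivative \<rho> (at p)) (at p)"
        using diff[OF V(2)] by (simp add: frechet_derivative_works)
      show "(\<forall>y\<in>ball p \<epsilon>. \<rho> y \<le> \<rho> p) \<or> (\<forall>y\<in>ball p \<epsilon>. \<rho> p \<le> \<rho> y)"
        using no_pos \<epsilon> \<open>\<rho> p = 0\<close> by auto
    qed (use \<epsilon> in auto)
    then show False using d by contradiction
  qed
qed

theorem theorem5:
  fixes D :: "(real ^ 'n::finite) set"
  assumes "odd CARD('n)"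
    and "domain_in D"
    and "bounded D"
    and "smooth_boundary D"
    and "polynomially_integrable D"
  shows "convex D"
proof -
  let ?K = "convex hull D"
  obtain M where dim: "DIM(real ^ 'n) = 2 * M + 1" using assms(1) by (auto elim: oddE)
  have D: "open D" "D \<noteq> {}" using assms(2) by (auto simp: domain_in_def)
  have "open ?K" using D by (simp add: open_convex_hull)
  have sub: "ball x \<epsilon> \<subseteq> D" if "x \<in> D" "\<epsilon> < \<delta>" "ball x \<delta> \<subseteq> ?K" for x \<epsilon> \<delta>
  proof (cases "\<epsilon> > 0")
    case True
    show ?thesis
      by (rule smooth_boundary_AE_imp_subset[OF D(1) assms(4) open_ball
          AE_ball_in_domain[OF assms(2,3,5) dim that(1,3) True that(2)]])
  qed (simp add: ball_empty)
  have "?K \<inter> closure D \<subseteq> D"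
  proof
    fix y assume y: "y \<in> ?K \<inter> closure D"
    then obtain d where d: "d > 0" "ball y d \<subseteq> ?K"
      using \<open>open ?K\<close> open_contains_ball by blast
    \<comment> \<open>Since 1/3 + 1/2 < 1, the ball of radius \<open>d / 2\<close> around
      \<open>x\<close> stays in \<open>ball y d\<close>, hence in the hull; the smaller ball of
      radius \<open>d / 3\<close> still contains \<open>y\<close>, and \<open>sub\<close> needs this
      strict gap between the radii.\<close>
    obtain x where x: "x \<in> D" "dist x y < d / 3"
      using y d by (metis IntD2 closure_approachable divide_pos_pos zero_less_numeral)
    have "ball x (d / 2) \<subseteq> ball y d"
    proof
      fix z assume "z \<in> ball x (d / 2)"
      then show "z \<in> ball y d" using x(2) d(1) dist_triangle[of y z x] by (simp add: dist_commute)
    qed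
    then have "ball x (d / 3) \<subseteq> D" using d x by (intro sub[of x _ "d / 2"]) auto
    then show "y \<in> D" using x(2) by auto
  qed
  then have "D = ?K \<inter> closure D" using hull_subset[of D convex] closure_subset[of D] by auto
  then have "closedin (top_of_set ?K) D" by (metis closedin_closed_Int closed_closure)
  moreover have "openin (top_of_set ?K) D"
    using D(1) by (intro open_subset) (auto simp: hull_inc)
  moreover have "connected ?K" by (simp add: convex_connected)
  ultimately have "D = ?K" using D(2) connected_clopen by blast
  then show ?thesis by (metis convex_convex_hull)
qed

end
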